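(* Mixed optics are a particular case of dependent optics, where the source bicategory has a unique object.
   Context: Mixed optics: let $(\mathcal{M},\otimes,I)$ be a monoidal category acting on categories $\mathcal{C}_L$ and $\mathcal{C}_R$, with actions denoted $\odot_L\colon \mathcal{M}\times\mathcal{C}_L\to\mathcal{C}_L$ and $\odot_R\colon\mathcal{M}\times\mathcal{C}_R\to\mathcal{C}_R$ (an action of $\mathcal{M}$ on $\mathcal{C}$ is a strong monoidal functor $\mathcal{M}\to[\mathcal{C},\mathcal{C}]$). The category of mixed optics for these actions has as objects pairs $(X,X')$ with $X\in\mathrm{Ob}(\mathcal{C}_L)$, $X'\in\mathrm{Ob}(\mathcal{C}_R)$; morphisms $(X,X')\to(Y,Y')$ are the elements of $\int^{M\in\mathcal{M}}\mathcal{C}_L(X,M\odot_L Y)\times\mathcal{C}_R(M\odot_R Y',X')$, i.e. equivalence classes of pairs $l\colon X\to M\odot_L Y$, $r\colon M\odot_R Y'\to X'$, where $M$ is called the representative. The composite of $(l_1,r_1)\colon(X,X')\to(Y,Y')$ with representative $M$ followed by $(l_2,r_2)\colon (Y,Y')\to(Z,Z')$ with representative $N$ has representative $M\otimes N$ and is given by $X\xrightarrow{l_1}M\odot_L Y\xrightarrow{M\odot_L l_2}M\odot_L(N\odot_L Z)\cong(M\otimes N)\odot_L Z$ and $(M\otimes N)\odot_R Z'\cong M\odot_R(N\odot_R Z')\xrightarrow{M\odot_R r_2}M\odot_R Y'\xrightarrow{r_1}X'$; identities are given by the unit isomorphisms $X\cong I\odot_L X$, $I\odot_R X'\cong X'$.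 Dependent optics: let $\mathcal{B}$ be a bicategory (the source bicategory); $\mathcal{B}(A,B)$ denotes the category of 1-morphisms $A\to B$ and 2-morphisms between them. A $\mathcal{B}$-indexed category is a pseudofunctor $\mathcal{B}^{\mathrm{op}}\to\mathbf{Cat}$, where $\mathcal{B}^{\mathrm{op}}$ reverses 1-morphisms only. Given $\mathcal{B}$-indexed categories $\mathcal{L},\mathcal{R}$, write $\mathcal{L}^A=\mathcal{L}(A)$, $\mathcal{R}^A=\mathcal{R}(A)$, $f^*=\mathcal{L}(f)$, $f^{*'}=\mathcal{R}(f)$; the coherence isomorphisms of $\mathcal{L}$ are $\theta_A\colon\mathrm{Id}_{\mathcal{L}^A}\Rightarrow \mathrm{Id}_A^*$ and $\theta_{f,g}\colon f^* g^*\Rightarrow (g\circ f)^*$, and analogously $\theta'$ for $\mathcal{R}$. The category $\mathbf{Optic}_{\mathcal{L},\mathcal{R}}$ of dependent optics has objects $(X,X')^A$ with $A\in\mathrm{Ob}(\mathcal{B})$, $X\in\mathrm{Ob}(\mathcal{L}^A)$, $X'\in\mathrm{Ob}(\mathcal{R}^A)$, and morphisms $(X,X')^A\to(Y,Y')^B$ the elements of $\int^{f\in\mathcal{B}(A,B)}\mathcal{L}^A(X,f^*Y)\times\mathcal{R}^A(f^{*'}Y',X')$; the class of $(l,r)$ is denoted $\langle l|r\rangle$ and $f$ is its representative. Identities are $\langle(\theta_A)_X|(\theta_A'^{-1})_{X'}\rangle$, and composition is $\langle l_2|r_2\rangle\circ\langle l_1|r_1\rangle=\langle(\theta_{f,g})_Z\circ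 f^*(l_2)\circ l_1\,|\,r_1\circ f^{*'}(r_2)\circ(\theta'^{-1}_{f,g})_{Z'}\rangle$ for representatives $f$ of $\langle l_1|r_1\rangle$ and $g$ of $\langle l_2|r_2\rangle$. All coends are assumed to exist. *)

theory Defs
  imports Main
begin

section \<open>Categories, functors, natural transformations\<close>

record ('o, 'a) cat =
  Obj :: "'o set"
  Arr :: "'a set"
  Dom :: "'a \<Rightarrow> 'o"
  Cod :: "'a \<Rightarrow> 'o"
  Id :: "'o \<Rightarrow> 'a"
  Comp :: "'a \<Rightarrow> 'a \<Rightarrow> 'a"  (infixl \<open>\<cdot>\<index>\<close> 70)

definition Hom :: "('o, 'a) cat \<Rightarrow> 'o \<Rightarrow> 'o \<Rightarrow> 'a set"
  where "Hom C X Y = {f \<in> Arr C. Dom C f = X \<and> Cod C f = Y}"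

locale category =
  fixes C :: "('o, 'a) cat" (structure)
  assumes Dom_closed: "f \<in> Arr C \<Longrightarrow> Dom C f \<in> Obj C"
    and Cod_closed: "f \<in> Arr C \<Longrightarrow> Cod C f \<in> Obj C"
    and Id_closed: "X \<in> Obj C \<Longrightarrow> Id C X \<in> Hom C X X"
    and Comp_closed: "f \<in> Hom C X Y \<Longrightarrow> g \<in> Hom C Y Z \<Longrightarrow> g \<cdot> f \<in> Hom C X Z"
    and Comp_assoc: "f \<in> Hom C W X \<Longrightarrow> g \<in> Hom C X Y \<Longrightarrow> h \<in> Hom C Y Z
      \<Longrightarrow> (h \<cdot> g) \<cdot> f = h \<cdot> (g \<cdot> f)"
    and Id_left: "f \<in> Hom C X Y \<Longrightarrow> Id C Y \<cdot> f = f"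
    and Id_right: "f \<in> Hom C X Y \<Longrightarrow> f \<cdot> Id C X = f"

definition inverse_arrows :: "('o, 'a) cat \<Rightarrow> 'a \<Rightarrow> 'a \<Rightarrow> bool"
  where "inverse_arrows C f g \<longleftrightarrow> f \<in> Arr C \<and> g \<in> Hom C (Cod C f) (Dom C f) \<and>
    g \<cdot>\<^bsub>C\<^esub> f = Id C (Dom C f) \<and> f \<cdot>\<^bsub>C\<^esub> g = Id C (Cod C f)"

definition iso_arr :: "('o, 'a) cat \<Rightarrow> 'a \<Rightarrow> bool"
  where "iso_arr C f \<longleftrightarrow> (\<exists>g. inverse_arrows C f g)"

definition inv_arr :: "('o, 'a) cat \<Rightarrow> 'a \<Rightarrow> 'a"
  where "inv_arr C f = (THE g. inverse_arrows C f g)"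

definition prod_cat :: "('o, 'a) cat \<Rightarrow> ('p, 'b) cat \<Rightarrow> ('o \<times> 'p, 'a \<times> 'b) cat"
  where "prod_cat C D = \<lparr>
    Obj = Obj C \<times> Obj D,
    Arr = Arr C \<times> Arr D,
    Dom = map_prod (Dom C) (Dom D),
    Cod = map_prod (Cod C) (Cod D),
    Id = map_prod (Id C) (Id D),
    Comp = (\<lambda>(g, g') (f, f'). (g \<cdot>\<^bsub>C\<^esub> f, g' \<cdot>\<^bsub>D\<^esub> f')) \<rparr>"

record ('o, 'a, 'p, 'b) ftr =
  OMap :: "'o \<Rightarrow> 'p"
  AMap :: "'a \<Rightarrow> 'b"

locale cat_functor = C: category C + D: category D
  for C :: "('o, 'a) cat" and D :: "('p, 'b) cat" and F :: "('o, 'a, 'p, 'b) ftr" +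
  assumes OMap_closed: "X \<in> Obj C \<Longrightarrow> OMap F X \<in> Obj D"
    and AMap_closed: "f \<in> Hom C X Y \<Longrightarrow> AMap F f \<in> Hom D (OMap F X) (OMap F Y)"
    and AMap_Id: "X \<in> Obj C \<Longrightarrow> AMap F (Id C X) = Id D (OMap F X)"
    and AMap_Comp: "f \<in> Hom C X Y \<Longrightarrow> g \<in> Hom C Y Z
      \<Longrightarrow> AMap F (g \<cdot>\<^bsub>C\<^esub> f) = AMap F g \<cdot>\<^bsub>D\<^esub> AMap F f"

definition id_ftr :: "('o, 'a, 'o, 'a) ftr"
  where "id_ftr = \<lparr> OMap = (\<lambda>X. X), AMap = (\<lambda>f. f) \<rparr>"

definition comp_ftr :: "('p, 'b, 'q, 'c) ftr \<Rightarrow> ('o, 'a, 'p, 'b) ftr \<Rightarrow> ('o, 'a, 'q, 'c) ftr"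
  where "comp_ftr G F = \<lparr> OMap = OMap G \<circ> OMap F, AMap = AMap G \<circ> AMap F \<rparr>"

text \<open>Functors are total functions on the underlying types, so equality of functors is
  tested on the carriers only.\<close>

definition eq_ftr :: "('o, 'a) cat \<Rightarrow> ('o, 'a, 'p, 'b) ftr \<Rightarrow> ('o, 'a, 'p, 'b) ftr \<Rightarrow> bool"
  where "eq_ftr C F G \<longleftrightarrow>
    (\<forall>X\<in>Obj C. OMap F X = OMap G X) \<and> (\<forall>f\<in>Arr C. AMap F f = AMap G f)"

definition iso_of_categories ::
    "('o, 'a) cat \<Rightarrow> ('p, 'b) cat \<Rightarrow> ('o, 'a, 'p, 'b) ftr \<Rightarrow> bool"
  where "iso_of_categories C D F \<longleftrightarrow> cat_functor C D F \<and>
    (\<exists>G. cat_functor D C G \<and> eq_ftr C (comp_ftr G F) id_ftr \<and> eq_ftr D (comp_ftr F G) id_ftr)"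

locale nat_trans = F: cat_functor C D F + G: cat_functor C D G
  for C :: "('o, 'a) cat" and D :: "('p, 'b) cat" and F G :: "('o, 'a, 'p, 'b) ftr"
    and \<tau> :: "'o \<Rightarrow> 'b" +
  assumes component_closed: "X \<in> Obj C \<Longrightarrow> \<tau> X \<in> Hom D (OMap F X) (OMap G X)"
    and naturality: "f \<in> Hom C X Y \<Longrightarrow> AMap G f \<cdot>\<^bsub>D\<^esub> \<tau> X = \<tau> Y \<cdot>\<^bsub>D\<^esub> AMap F f"

locale nat_iso = nat_trans +
  assumes component_iso: "X \<in> Obj C \<Longrightarrow> iso_arr D (\<tau> X)"

section \<open>Monoidal categories and their actions\<close>

record ('o, 'a) mon =
  Ground :: "('o, 'a) cat"
  Tensor :: "('o \<times> 'o, 'a \<times> 'a, 'o, 'a) ftr"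
  Unit :: 'o
  Assoc :: "'o \<Rightarrow> 'o \<Rightarrow> 'o \<Rightarrow> 'a"
  LUnit :: "'o \<Rightarrow> 'a"
  RUnit :: "'o \<Rightarrow> 'a"

definition tensO :: "('o, 'a) mon \<Rightarrow> 'o \<Rightarrow> 'o \<Rightarrow> 'o"
  where "tensO M a b = OMap (Tensor M) (a, b)"

definition tensA :: "('o, 'a) mon \<Rightarrow> 'a \<Rightarrow> 'a \<Rightarrow> 'a"
  where "tensA M f g = AMap (Tensor M) (f, g)"

locale monoidal_category =
  fixes M :: "('o, 'a) mon"
  fixes C and obtens (infixr \<open>\<otimes>\<close> 75) and artens (infixr \<open>\<otimes>\<^sub>a\<close> 75)
    and comp (infixl \<open>\<cdot>\<close> 70) and \<alpha> lu ru
  defines "C \<equiv> Ground M" and "obtens \<equiv> tensO M" and "artens \<equiv> tensA M" and "comp \<equiv> Comp C"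
    and "\<alpha> \<equiv> Assoc M" and "lu \<equiv> LUnit M" and "ru \<equiv> RUnit M"
  assumes tensor_functor: "cat_functor (prod_cat C C) C (Tensor M)"
    and ground_category: "category C"
    and unit_closed: "Unit M \<in> Obj C"
    and assoc_closed: "a \<in> Obj C \<Longrightarrow> b \<in> Obj C \<Longrightarrow> c \<in> Obj C
      \<Longrightarrow> \<alpha> a b c \<in> Hom C ((a \<otimes> b) \<otimes> c) (a \<otimes> (b \<otimes> c))"
    and assoc_iso: "a \<in> Obj C \<Longrightarrow> b \<in> Obj C \<Longrightarrow> c \<in> Obj C \<Longrightarrow> iso_arr C (\<alpha> a b c)"
    and assoc_natural: "f \<in> Hom C a a' \<Longrightarrow> g \<in> Hom C b b' \<Longrightarrow> h \<in> Hom C c c'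
      \<Longrightarrow> (f \<otimes>\<^sub>a (g \<otimes>\<^sub>a h)) \<cdot> \<alpha> a b c = \<alpha> a' b' c' \<cdot> ((f \<otimes>\<^sub>a g) \<otimes>\<^sub>a h)"
    and lunit_closed: "a \<in> Obj C \<Longrightarrow> lu a \<in> Hom C (Unit M \<otimes> a) a"
    and lunit_iso: "a \<in> Obj C \<Longrightarrow> iso_arr C (lu a)"
    and lunit_natural: "f \<in> Hom C a b \<Longrightarrow> f \<cdot> lu a = lu b \<cdot> (Id C (Unit M) \<otimes>\<^sub>a f)"
    and runit_closed: "a \<in> Obj C \<Longrightarrow> ru a \<in> Hom C (a \<otimes> Unit M) a"
    and runit_iso: "a \<in> Obj C \<Longrightarrow> iso_arr C (ru a)"
    and runit_natural: "f \<in> Hom C a b \<Longrightarrow> f \<cdot> ru a = ru b \<cdot> (f \<otimes>\<^sub>a Id C (Unit M))"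
    and pentagon: "a \<in> Obj C \<Longrightarrow> b \<in> Obj C \<Longrightarrow> c \<in> Obj C \<Longrightarrow> d \<in> Obj C
      \<Longrightarrow> \<alpha> a b (c \<otimes> d) \<cdot> \<alpha> (a \<otimes> b) c d
        = (Id C a \<otimes>\<^sub>a \<alpha> b c d) \<cdot> \<alpha> a (b \<otimes> c) d \<cdot> (\<alpha> a b c \<otimes>\<^sub>a Id C d)"
    and triangle: "a \<in> Obj C \<Longrightarrow> b \<in> Obj C
      \<Longrightarrow> (Id C a \<otimes>\<^sub>a lu b) \<cdot> \<alpha> a (Unit M) b = ru a \<otimes>\<^sub>a Id C b"

text \<open>A strong monoidal functor from \<open>M\<close> to the strict monoidal category of endofunctors of
  \<open>C\<close> (with composition as tensor product), given by its components: \<open>ActF m\<close> is the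
  endofunctor \<open>m \<odot> _\<close>, \<open>ActN f\<close> the natural transformation \<open>f \<odot> _\<close>, and the structure
  isomorphisms are \<open>ActU x : x \<rightarrow> I \<odot> x\<close> and
  \<open>ActM m n x : m \<odot> (n \<odot> x) \<rightarrow> (m \<otimes> n) \<odot> x\<close>.\<close>

record ('m, 'f, 'x, 'y) act =
  ActF :: "'m \<Rightarrow> ('x, 'y, 'x, 'y) ftr"
  ActN :: "'f \<Rightarrow> 'x \<Rightarrow> 'y"
  ActU :: "'x \<Rightarrow> 'y"
  ActM :: "'m \<Rightarrow> 'm \<Rightarrow> 'x \<Rightarrow> 'y"

definition actO :: "('m, 'f, 'x, 'y) act \<Rightarrow> 'm \<Rightarrow> 'x \<Rightarrow> 'x"
  where "actO a m = OMap (ActF a m)"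

definition actA :: "('m, 'f, 'x, 'y) act \<Rightarrow> 'm \<Rightarrow> 'y \<Rightarrow> 'y"
  where "actA a m = AMap (ActF a m)"

locale action =
  fixes M :: "('m, 'f) mon" and C :: "('x, 'y) cat" and a :: "('m, 'f, 'x, 'y) act"
  fixes V and I and comp (infixl \<open>\<cdot>\<close> 70) and ob (infixr \<open>\<odot>\<close> 75) and ar (infixr \<open>\<odot>\<^sub>a\<close> 75)
    and tens (infixr \<open>\<otimes>\<close> 75) and \<epsilon> \<mu>
  defines "V \<equiv> Ground M" and "I \<equiv> Unit M" and "comp \<equiv> Comp C" and "ob \<equiv> actO a" and "ar \<equiv> actA a"
    and "tens \<equiv> tensO M" and "\<epsilon> \<equiv> ActU a" and "\<mu> \<equiv> ActM a"
  assumes monoidal: "monoidal_category M"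
    and functor_of_object: "m \<in> Obj V \<Longrightarrow> cat_functor C C (ActF a m)"
    and nat_trans_of_arrow: "f \<in> Hom V m n \<Longrightarrow> nat_trans C C (ActF a m) (ActF a n) (ActN a f)"
    and act_Id: "m \<in> Obj V \<Longrightarrow> x \<in> Obj C \<Longrightarrow> ActN a (Id V m) x = Id C (m \<odot> x)"
    and act_Comp: "f \<in> Hom V m n \<Longrightarrow> g \<in> Hom V n p \<Longrightarrow> x \<in> Obj C
      \<Longrightarrow> ActN a (g \<cdot>\<^bsub>V\<^esub> f) x = ActN a g x \<cdot> ActN a f x"
    and unit_nat_iso: "nat_iso C C id_ftr (ActF a I) \<epsilon>"
    and mult_nat_iso: "m \<in> Obj V \<Longrightarrow> n \<in> Obj V
      \<Longrightarrow> nat_iso C C (comp_ftr (ActF a m) (ActF a n)) (ActF a (m \<otimes> n)) (\<mu> m n)"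
    and mult_natural: "f \<in> Hom V m m' \<Longrightarrow> g \<in> Hom V n n' \<Longrightarrow> x \<in> Obj C
      \<Longrightarrow> ActN a (tensA M f g) x \<cdot> \<mu> m n x
        = \<mu> m' n' x \<cdot> (ActN a f (n' \<odot> x) \<cdot> (m \<odot>\<^sub>a ActN a g x))"
    and coherence_assoc: "m \<in> Obj V \<Longrightarrow> n \<in> Obj V \<Longrightarrow> p \<in> Obj V \<Longrightarrow> x \<in> Obj C
      \<Longrightarrow> ActN a (Assoc M m n p) x \<cdot> (\<mu> (m \<otimes> n) p x \<cdot> \<mu> m n (p \<odot> x))
        = \<mu> m (n \<otimes> p) x \<cdot> (m \<odot>\<^sub>a \<mu> n p x)"
    and coherence_lunit: "m \<in> Obj V \<Longrightarrow> x \<in> Obj C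
      \<Longrightarrow> ActN a (LUnit M m) x \<cdot> (\<mu> I m x \<cdot> \<epsilon> (m \<odot> x)) = Id C (m \<odot> x)"
    and coherence_runit: "m \<in> Obj V \<Longrightarrow> x \<in> Obj C
      \<Longrightarrow> ActN a (RUnit M m) x \<cdot> (\<mu> m I x \<cdot> (m \<odot>\<^sub>a \<epsilon> x)) = Id C (m \<odot> x)"

section \<open>Bicategories and indexed categories\<close>

text \<open>\<open>HComp Q A B C\<close> is the horizontal composition functor
  \<open>Q(B, C) \<times> Q(A, B) \<rightarrow> Q(A, C)\<close>, \<open>BAssoc Q A B C D h g f\<close> is the associator
  \<open>(h \<circ> g) \<circ> f \<Rightarrow> h \<circ> (g \<circ> f)\<close>, and \<open>BLUnit Q A B f\<close>, \<open>BRUnit Q A B f\<close> are the unitors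
  \<open>id\<^sub>B \<circ> f \<Rightarrow> f\<close> and \<open>f \<circ> id\<^sub>A \<Rightarrow> f\<close>.\<close>

record ('b, 'f, 's) bicat =
  BObj :: "'b set"
  BHom :: "'b \<Rightarrow> 'b \<Rightarrow> ('f, 's) cat"
  BId :: "'b \<Rightarrow> 'f"
  HComp :: "'b \<Rightarrow> 'b \<Rightarrow> 'b \<Rightarrow> ('f \<times> 'f, 's \<times> 's, 'f, 's) ftr"
  BAssoc :: "'b \<Rightarrow> 'b \<Rightarrow> 'b \<Rightarrow> 'b \<Rightarrow> 'f \<Rightarrow> 'f \<Rightarrow> 'f \<Rightarrow> 's"
  BLUnit :: "'b \<Rightarrow> 'b \<Rightarrow> 'f \<Rightarrow> 's"
  BRUnit :: "'b \<Rightarrow> 'b \<Rightarrow> 'f \<Rightarrow> 's"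

definition comp1 :: "('b, 'f, 's) bicat \<Rightarrow> 'b \<Rightarrow> 'b \<Rightarrow> 'b \<Rightarrow> 'f \<Rightarrow> 'f \<Rightarrow> 'f"
  where "comp1 Q A B C g f = OMap (HComp Q A B C) (g, f)"

definition comp2 :: "('b, 'f, 's) bicat \<Rightarrow> 'b \<Rightarrow> 'b \<Rightarrow> 'b \<Rightarrow> 's \<Rightarrow> 's \<Rightarrow> 's"
  where "comp2 Q A B C \<beta> \<alpha> = AMap (HComp Q A B C) (\<beta>, \<alpha>)"

locale bicategory =
  fixes Q :: "('b, 'f, 's) bicat"
  fixes Ob and H and one and c1 and c2 and assoc and lunit and runit
  defines "Ob \<equiv> BObj Q" and "H \<equiv> BHom Q" and "one \<equiv> BId Q" and "c1 \<equiv> comp1 Q" and "c2 \<equiv> comp2 Q"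
    and "assoc \<equiv> BAssoc Q" and "lunit \<equiv> BLUnit Q" and "runit \<equiv> BRUnit Q"
  assumes hom_category: "A \<in> Ob \<Longrightarrow> B \<in> Ob \<Longrightarrow> category (H A B)"
    and id_closed: "A \<in> Ob \<Longrightarrow> one A \<in> Obj (H A A)"
    and hcomp_functor: "A \<in> Ob \<Longrightarrow> B \<in> Ob \<Longrightarrow> C \<in> Ob
      \<Longrightarrow> cat_functor (prod_cat (H B C) (H A B)) (H A C) (HComp Q A B C)"
    and assoc_closed: "A \<in> Ob \<Longrightarrow> B \<in> Ob \<Longrightarrow> C \<in> Ob \<Longrightarrow> D \<in> Ob
      \<Longrightarrow> f \<in> Obj (H A B) \<Longrightarrow> g \<in> Obj (H B C) \<Longrightarrow> h \<in> Obj (H C D)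
      \<Longrightarrow> assoc A B C D h g f \<in>
        Hom (H A D) (c1 A B D (c1 B C D h g) f) (c1 A C D h (c1 A B C g f))"
    and assoc_iso: "A \<in> Ob \<Longrightarrow> B \<in> Ob \<Longrightarrow> C \<in> Ob \<Longrightarrow> D \<in> Ob
      \<Longrightarrow> f \<in> Obj (H A B) \<Longrightarrow> g \<in> Obj (H B C) \<Longrightarrow> h \<in> Obj (H C D)
      \<Longrightarrow> iso_arr (H A D) (assoc A B C D h g f)"
    and assoc_natural: "A \<in> Ob \<Longrightarrow> B \<in> Ob \<Longrightarrow> C \<in> Ob \<Longrightarrow> D \<in> Ob
      \<Longrightarrow> \<phi> \<in> Hom (H A B) f f' \<Longrightarrow> \<gamma> \<in> Hom (H B C) g g' \<Longrightarrow> \<eta> \<in> Hom (H C D) h h'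
      \<Longrightarrow> c2 A C D \<eta> (c2 A B C \<gamma> \<phi>) \<cdot>\<^bsub>H A D\<^esub> assoc A B C D h g f
        = assoc A B C D h' g' f' \<cdot>\<^bsub>H A D\<^esub> c2 A B D (c2 B C D \<eta> \<gamma>) \<phi>"
    and lunit_closed: "A \<in> Ob \<Longrightarrow> B \<in> Ob \<Longrightarrow> f \<in> Obj (H A B)
      \<Longrightarrow> lunit A B f \<in> Hom (H A B) (c1 A B B (one B) f) f"
    and lunit_iso: "A \<in> Ob \<Longrightarrow> B \<in> Ob \<Longrightarrow> f \<in> Obj (H A B) \<Longrightarrow> iso_arr (H A B) (lunit A B f)"
    and lunit_natural: "A \<in> Ob \<Longrightarrow> B \<in> Ob \<Longrightarrow> \<phi> \<in> Hom (H A B) f f'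
      \<Longrightarrow> \<phi> \<cdot>\<^bsub>H A B\<^esub> lunit A B f = lunit A B f' \<cdot>\<^bsub>H A B\<^esub> c2 A B B (Id (H B B) (one B)) \<phi>"
    and runit_closed: "A \<in> Ob \<Longrightarrow> B \<in> Ob \<Longrightarrow> f \<in> Obj (H A B)
      \<Longrightarrow> runit A B f \<in> Hom (H A B) (c1 A A B f (one A)) f"
    and runit_iso: "A \<in> Ob \<Longrightarrow> B \<in> Ob \<Longrightarrow> f \<in> Obj (H A B) \<Longrightarrow> iso_arr (H A B) (runit A B f)"
    and runit_natural: "A \<in> Ob \<Longrightarrow> B \<in> Ob \<Longrightarrow> \<phi> \<in> Hom (H A B) f f'
      \<Longrightarrow> \<phi> \<cdot>\<^bsub>H A B\<^esub> runit A B f = runit A B f' \<cdot>\<^bsub>H A B\<^esub> c2 A A B \<phi> (Id (H A A) (one A))"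
    and pentagon: "A \<in> Ob \<Longrightarrow> B \<in> Ob \<Longrightarrow> C \<in> Ob \<Longrightarrow> D \<in> Ob \<Longrightarrow> E \<in> Ob
      \<Longrightarrow> f \<in> Obj (H A B) \<Longrightarrow> g \<in> Obj (H B C) \<Longrightarrow> h \<in> Obj (H C D) \<Longrightarrow> k \<in> Obj (H D E)
      \<Longrightarrow> assoc A C D E k h (c1 A B C g f) \<cdot>\<^bsub>H A E\<^esub> assoc A B C E (c1 C D E k h) g f
        = c2 A D E (Id (H D E) k) (assoc A B C D h g f)
          \<cdot>\<^bsub>H A E\<^esub> assoc A B D E k (c1 B C D h g) f
          \<cdot>\<^bsub>H A E\<^esub> c2 A B E (assoc B C D E k h g) (Id (H A B) f)"
    and triangle: "A \<in> Ob \<Longrightarrow> B \<in> Ob \<Longrightarrow> C \<in> Ob \<Longrightarrow> f \<in> Obj (H A B) \<Longrightarrow> g \<in> Obj (H B C)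
      \<Longrightarrow> c2 A B C (Id (H B C) g) (lunit A B f) \<cdot>\<^bsub>H A C\<^esub> assoc A B B C g (one B) f
        = c2 A B C (runit B C g) (Id (H A B) f)"

text \<open>A pseudofunctor from \<open>Q\<close>, with 1-morphisms reversed, to categories, given by its
  components: \<open>Fib L A\<close> is the category \<open>L(A)\<close>; \<open>Pull L A B f\<close> is the functor
  \<open>f\<^sup>* : L(B) \<rightarrow> L(A)\<close> for \<open>f : A \<rightarrow> B\<close>; \<open>PullN L A B \<phi>\<close> is the natural transformation induced
  by a 2-morphism \<open>\<phi>\<close> between 1-morphisms \<open>A \<rightarrow> B\<close>; \<open>ThU L A\<close> is
  \<open>\<theta>\<^sub>A : Id \<Rightarrow> id\<^sub>A\<^sup>*\<close>; and \<open>ThC L A B C f g\<close> is \<open>\<theta>\<^sub>f\<^sub>,\<^sub>g : f\<^sup>* g\<^sup>* \<Rightarrow> (g \<circ> f)\<^sup>*\<close>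
  for \<open>f : A \<rightarrow> B\<close> and \<open>g : B \<rightarrow> C\<close>.\<close>

record ('b, 'f, 's, 'x, 'y) idx =
  Fib :: "'b \<Rightarrow> ('x, 'y) cat"
  Pull :: "'b \<Rightarrow> 'b \<Rightarrow> 'f \<Rightarrow> ('x, 'y, 'x, 'y) ftr"
  PullN :: "'b \<Rightarrow> 'b \<Rightarrow> 's \<Rightarrow> 'x \<Rightarrow> 'y"
  ThU :: "'b \<Rightarrow> 'x \<Rightarrow> 'y"
  ThC :: "'b \<Rightarrow> 'b \<Rightarrow> 'b \<Rightarrow> 'f \<Rightarrow> 'f \<Rightarrow> 'x \<Rightarrow> 'y"

definition pullO :: "('b, 'f, 's, 'x, 'y) idx \<Rightarrow> 'b \<Rightarrow> 'b \<Rightarrow> 'f \<Rightarrow> 'x \<Rightarrow> 'x"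
  where "pullO L A B f = OMap (Pull L A B f)"

definition pullA :: "('b, 'f, 's, 'x, 'y) idx \<Rightarrow> 'b \<Rightarrow> 'b \<Rightarrow> 'f \<Rightarrow> 'y \<Rightarrow> 'y"
  where "pullA L A B f = AMap (Pull L A B f)"

locale indexed_category =
  fixes Q :: "('b, 'f, 's) bicat" and L :: "('b, 'f, 's, 'x, 'y) idx"
  fixes Ob and H and one and c1 and N and \<theta>\<^sub>1 and \<theta>
  defines "Ob \<equiv> BObj Q" and "H \<equiv> BHom Q" and "one \<equiv> BId Q" and "c1 \<equiv> comp1 Q"
    and "N \<equiv> PullN L" and "\<theta>\<^sub>1 \<equiv> ThU L" and "\<theta> \<equiv> ThC L"
  assumes bicategory: "bicategory Q"
    and fibre_category: "A \<in> Ob \<Longrightarrow> category (Fib L A)"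
    and pull_functor: "A \<in> Ob \<Longrightarrow> B \<in> Ob \<Longrightarrow> f \<in> Obj (H A B)
      \<Longrightarrow> cat_functor (Fib L B) (Fib L A) (Pull L A B f)"
    and pull_nat_trans: "A \<in> Ob \<Longrightarrow> B \<in> Ob \<Longrightarrow> \<phi> \<in> Hom (H A B) f f'
      \<Longrightarrow> nat_trans (Fib L B) (Fib L A) (Pull L A B f) (Pull L A B f') (N A B \<phi>)"
    and pull_Id: "A \<in> Ob \<Longrightarrow> B \<in> Ob \<Longrightarrow> f \<in> Obj (H A B) \<Longrightarrow> X \<in> Obj (Fib L B)
      \<Longrightarrow> N A B (Id (H A B) f) X = Id (Fib L A) (pullO L A B f X)"
    and pull_Comp: "A \<in> Ob \<Longrightarrow> B \<in> Ob \<Longrightarrow> \<phi> \<in> Hom (H A B) f f' \<Longrightarrow> \<psi> \<in> Hom (H A B) f' f''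
      \<Longrightarrow> X \<in> Obj (Fib L B) \<Longrightarrow> N A B (\<psi> \<cdot>\<^bsub>H A B\<^esub> \<phi>) X = N A B \<psi> X \<cdot>\<^bsub>Fib L A\<^esub> N A B \<phi> X"
    and unit_nat_iso: "A \<in> Ob \<Longrightarrow> nat_iso (Fib L A) (Fib L A) id_ftr (Pull L A A (one A)) (\<theta>\<^sub>1 A)"
    and comp_nat_iso: "A \<in> Ob \<Longrightarrow> B \<in> Ob \<Longrightarrow> C \<in> Ob \<Longrightarrow> f \<in> Obj (H A B) \<Longrightarrow> g \<in> Obj (H B C)
      \<Longrightarrow> nat_iso (Fib L C) (Fib L A) (comp_ftr (Pull L A B f) (Pull L B C g))
        (Pull L A C (c1 A B C g f)) (\<theta> A B C f g)"
    and comp_natural: "A \<in> Ob \<Longrightarrow> B \<in> Ob \<Longrightarrow> C \<in> Ob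
      \<Longrightarrow> \<phi> \<in> Hom (H A B) f f' \<Longrightarrow> \<gamma> \<in> Hom (H B C) g g' \<Longrightarrow> X \<in> Obj (Fib L C)
      \<Longrightarrow> N A C (comp2 Q A B C \<gamma> \<phi>) X \<cdot>\<^bsub>Fib L A\<^esub> \<theta> A B C f g X
        = \<theta> A B C f' g' X \<cdot>\<^bsub>Fib L A\<^esub>
          (N A B \<phi> (pullO L B C g' X) \<cdot>\<^bsub>Fib L A\<^esub> pullA L A B f (N B C \<gamma> X))"
    and coherence_assoc: "A \<in> Ob \<Longrightarrow> B \<in> Ob \<Longrightarrow> C \<in> Ob \<Longrightarrow> D \<in> Ob
      \<Longrightarrow> f \<in> Obj (H A B) \<Longrightarrow> g \<in> Obj (H B C) \<Longrightarrow> h \<in> Obj (H C D) \<Longrightarrow> X \<in> Obj (Fib L D)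
      \<Longrightarrow> \<theta> A C D (c1 A B C g f) h X \<cdot>\<^bsub>Fib L A\<^esub> \<theta> A B C f g (pullO L C D h X)
        = N A D (BAssoc Q A B C D h g f) X \<cdot>\<^bsub>Fib L A\<^esub>
          (\<theta> A B D f (c1 B C D h g) X \<cdot>\<^bsub>Fib L A\<^esub> pullA L A B f (\<theta> B C D g h X))"
    and coherence_lunit: "A \<in> Ob \<Longrightarrow> B \<in> Ob \<Longrightarrow> f \<in> Obj (H A B) \<Longrightarrow> X \<in> Obj (Fib L B)
      \<Longrightarrow> N A B (BLUnit Q A B f) X \<cdot>\<^bsub>Fib L A\<^esub>
          (\<theta> A B B f (one B) X \<cdot>\<^bsub>Fib L A\<^esub> pullA L A B f (\<theta>\<^sub>1 B X))
        = Id (Fib L A) (pullO L A B f X)"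
    and coherence_runit: "A \<in> Ob \<Longrightarrow> B \<in> Ob \<Longrightarrow> f \<in> Obj (H A B) \<Longrightarrow> X \<in> Obj (Fib L B)
      \<Longrightarrow> N A B (BRUnit Q A B f) X \<cdot>\<^bsub>Fib L A\<^esub>
          (\<theta> A A B (one A) f X \<cdot>\<^bsub>Fib L A\<^esub> \<theta>\<^sub>1 A (pullO L A B f X))
        = Id (Fib L A) (pullO L A B f X)"

section \<open>Coends of sets\<close>

text \<open>The coend of \<open>P : D\<^sup>o\<^sup>p \<times> D \<rightarrow> Set\<close> (contravariant in its first argument), where
  \<open>P\<^sub>a u v : P (Cod u) (Dom v) \<rightarrow> P (Dom u) (Cod v)\<close> is the action on arrows: the quotient of
  the disjoint union of the sets \<open>P m m\<close> by the equivalence relation generated by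
  \<open>coend_step\<close>.\<close>

definition coend_step ::
    "('o, 'a) cat \<Rightarrow> ('o \<Rightarrow> 'o \<Rightarrow> 'e set) \<Rightarrow> ('a \<Rightarrow> 'a \<Rightarrow> 'e \<Rightarrow> 'e) \<Rightarrow> 'o \<times> 'e \<Rightarrow> 'o \<times> 'e \<Rightarrow> bool"
  where "coend_step D P P\<^sub>a p q \<longleftrightarrow> (\<exists>f\<in>Arr D. \<exists>x\<in>P (Cod D f) (Dom D f).
    p = (Dom D f, P\<^sub>a f (Id D (Dom D f)) x) \<and> q = (Cod D f, P\<^sub>a (Id D (Cod D f)) f x))"

definition coend_class ::
    "('o, 'a) cat \<Rightarrow> ('o \<Rightarrow> 'o \<Rightarrow> 'e set) \<Rightarrow> ('a \<Rightarrow> 'a \<Rightarrow> 'e \<Rightarrow> 'e) \<Rightarrow> 'o \<times> 'e \<Rightarrow> ('o \<times> 'e) set"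
  where "coend_class D P P\<^sub>a p =
    {q \<in> (SIGMA m:Obj D. P m m). equivclp (coend_step D P P\<^sub>a) p q}"

definition coend ::
    "('o, 'a) cat \<Rightarrow> ('o \<Rightarrow> 'o \<Rightarrow> 'e set) \<Rightarrow> ('a \<Rightarrow> 'a \<Rightarrow> 'e \<Rightarrow> 'e) \<Rightarrow> ('o \<times> 'e) set set"
  where "coend D P P\<^sub>a = coend_class D P P\<^sub>a ` (SIGMA m:Obj D. P m m)"

section \<open>Mixed optics\<close>

text \<open>Both for mixed and for dependent optics, an arrow is a triple consisting of its domain, its
  codomain and a coend class of triples \<open>(m, l, r)\<close> with representative \<open>m\<close>.\<close>

context
  fixes M :: "('m, 'f) mon"
    and CL :: "('x, 'y) cat" and CR :: "('z, 'w) cat"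
    and aL :: "('m, 'f, 'x, 'y) act" and aR :: "('m, 'f, 'z, 'w) act"
begin

definition mixed_set :: "'x \<times> 'z \<Rightarrow> 'x \<times> 'z \<Rightarrow> 'm \<Rightarrow> 'm \<Rightarrow> ('y \<times> 'w) set"
  where "mixed_set = (\<lambda>(X, X') (Y, Y') m' m.
    Hom CL X (actO aL m Y) \<times> Hom CR (actO aR m' Y') X')"

definition mixed_map :: "'x \<times> 'z \<Rightarrow> 'x \<times> 'z \<Rightarrow> 'f \<Rightarrow> 'f \<Rightarrow> 'y \<times> 'w \<Rightarrow> 'y \<times> 'w"
  where "mixed_map = (\<lambda>(X, X') (Y, Y') u v (l, r).
    (ActN aL v Y \<cdot>\<^bsub>CL\<^esub> l, r \<cdot>\<^bsub>CR\<^esub> ActN aR u Y'))"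

definition mixed_class :: "'x \<times> 'z \<Rightarrow> 'x \<times> 'z \<Rightarrow> 'm \<times> 'y \<times> 'w \<Rightarrow> ('m \<times> 'y \<times> 'w) set"
  where "mixed_class S T = coend_class (Ground M) (mixed_set S T) (mixed_map S T)"

definition mixed_id_rep :: "'x \<times> 'z \<Rightarrow> 'm \<times> 'y \<times> 'w"
  where "mixed_id_rep = (\<lambda>(X, X'). (Unit M, ActU aL X, inv_arr CR (ActU aR X')))"

text \<open>The arguments are the codomain of the composite, the second optic and the first one.\<close>

definition mixed_comp_rep :: "'x \<times> 'z \<Rightarrow> 'm \<times> 'y \<times> 'w \<Rightarrow> 'm \<times> 'y \<times> 'w \<Rightarrow> 'm \<times> 'y \<times> 'w"
  where "mixed_comp_rep = (\<lambda>(Z, Z') (n, l2, r2) (m, l1, r1).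
    (tensO M m n,
     ActM aL m n Z \<cdot>\<^bsub>CL\<^esub> (actA aL m l2 \<cdot>\<^bsub>CL\<^esub> l1),
     r1 \<cdot>\<^bsub>CR\<^esub> (actA aR m r2 \<cdot>\<^bsub>CR\<^esub> inv_arr CR (ActM aR m n Z'))))"

definition mixed_optics ::
    "('x \<times> 'z, ('x \<times> 'z) \<times> ('x \<times> 'z) \<times> ('m \<times> 'y \<times> 'w) set) cat"
  where "mixed_optics = \<lparr>
    Obj = Obj CL \<times> Obj CR,
    Arr = {(S, T, c). S \<in> Obj CL \<times> Obj CR \<and> T \<in> Obj CL \<times> Obj CR \<and>
      c \<in> coend (Ground M) (mixed_set S T) (mixed_map S T)},
    Dom = (\<lambda>(S, T, c). S),
    Cod = (\<lambda>(S, T, c). T),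
    Id = (\<lambda>S. (S, S, mixed_class S S (mixed_id_rep S))),
    Comp = (\<lambda>(_, U, d) (S, _, c).
      (S, U, \<Union>p\<in>c. \<Union>q\<in>d. mixed_class S U (mixed_comp_rep U q p))) \<rparr>"

end

section \<open>Dependent optics\<close>

text \<open>The triple \<open>(A, X, X')\<close> stands for the object \<open>(X, X')\<^sup>A\<close>.\<close>

context
  fixes Q :: "('b, 'f, 's) bicat"
    and L :: "('b, 'f, 's, 'x, 'y) idx" and R :: "('b, 'f, 's, 'z, 'w) idx"
begin

definition optic_set :: "'b \<times> 'x \<times> 'z \<Rightarrow> 'b \<times> 'x \<times> 'z \<Rightarrow> 'f \<Rightarrow> 'f \<Rightarrow> ('y \<times> 'w) set"
  where "optic_set = (\<lambda>(A, X, X') (B, Y, Y') f' f.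
    Hom (Fib L A) X (pullO L A B f Y) \<times> Hom (Fib R A) (pullO R A B f' Y') X')"

definition optic_map :: "'b \<times> 'x \<times> 'z \<Rightarrow> 'b \<times> 'x \<times> 'z \<Rightarrow> 's \<Rightarrow> 's \<Rightarrow> 'y \<times> 'w \<Rightarrow> 'y \<times> 'w"
  where "optic_map = (\<lambda>(A, X, X') (B, Y, Y') u v (l, r).
    (PullN L A B v Y \<cdot>\<^bsub>Fib L A\<^esub> l, r \<cdot>\<^bsub>Fib R A\<^esub> PullN R A B u Y'))"

definition optic_hom :: "'b \<times> 'x \<times> 'z \<Rightarrow> 'b \<times> 'x \<times> 'z \<Rightarrow> ('f \<times> 'y \<times> 'w) set set"
  where "optic_hom S T = coend (BHom Q (fst S) (fst T)) (optic_set S T) (optic_map S T)"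

definition optic_class :: "'b \<times> 'x \<times> 'z \<Rightarrow> 'b \<times> 'x \<times> 'z \<Rightarrow> 'f \<times> 'y \<times> 'w \<Rightarrow> ('f \<times> 'y \<times> 'w) set"
  where "optic_class S T = coend_class (BHom Q (fst S) (fst T)) (optic_set S T) (optic_map S T)"

definition optic_id_rep :: "'b \<times> 'x \<times> 'z \<Rightarrow> 'f \<times> 'y \<times> 'w"
  where "optic_id_rep = (\<lambda>(A, X, X'). (BId Q A, ThU L A X, inv_arr (Fib R A) (ThU R A X')))"

text \<open>The arguments are the base objects of the domain and of the intermediate object, the codomain
  of the composite, the second optic and the first one.\<close>

definition optic_comp_rep ::
    "'b \<Rightarrow> 'b \<Rightarrow> 'b \<times> 'x \<times> 'z \<Rightarrow> 'f \<times> 'y \<times> 'w \<Rightarrow> 'f \<times> 'y \<times> 'w \<Rightarrow> 'f \<times> 'y \<times> 'w"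
  where "optic_comp_rep A B = (\<lambda>(C, Z, Z') (g, l2, r2) (f, l1, r1).
    (comp1 Q A B C g f,
     ThC L A B C f g Z \<cdot>\<^bsub>Fib L A\<^esub> (pullA L A B f l2 \<cdot>\<^bsub>Fib L A\<^esub> l1),
     r1 \<cdot>\<^bsub>Fib R A\<^esub> (pullA R A B f r2 \<cdot>\<^bsub>Fib R A\<^esub> inv_arr (Fib R A) (ThC R A B C f g Z'))))"

definition dependent_optics ::
    "('b \<times> 'x \<times> 'z, ('b \<times> 'x \<times> 'z) \<times> ('b \<times> 'x \<times> 'z) \<times> ('f \<times> 'y \<times> 'w) set) cat"
  where "dependent_optics = (let Ob = (SIGMA A:BObj Q. Obj (Fib L A) \<times> Obj (Fib R A)) in \<lparr>
    Obj = Ob,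
    Arr = {(S, T, c). S \<in> Ob \<and> T \<in> Ob \<and> c \<in> optic_hom S T},
    Dom = (\<lambda>(S, T, c). S),
    Cod = (\<lambda>(S, T, c). T),
    Id = (\<lambda>S. (S, S, optic_class S S (optic_id_rep S))),
    Comp = (\<lambda>(_, U, d) (S, T, c).
      (S, U, \<Union>p\<in>c. \<Union>q\<in>d. optic_class S U (optic_comp_rep (fst S) (fst T) U q p))) \<rparr>)"

end

section \<open>Mixed optics as dependent optics\<close>

text \<open>The bicategory with a single object whose hom category is the ground category of \<open>M\<close>.
  The composite \<open>g \<circ> f\<close> is \<open>f \<otimes> g\<close>, so that the contravariance of indexed categories matches
  \<open>f \<odot> (g \<odot> x) \<cong> (f \<otimes> g) \<odot> x\<close>. Reversing the tensor product inverts the associator and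
  exchanges the unitors.\<close>

definition deloop :: "('m, 'f) mon \<Rightarrow> (unit, 'm, 'f) bicat"
  where "deloop M = \<lparr>
    BObj = {()},
    BHom = (\<lambda>_ _. Ground M),
    BId = (\<lambda>_. Unit M),
    HComp = (\<lambda>_ _ _. \<lparr> OMap = (\<lambda>(g, f). tensO M f g), AMap = (\<lambda>(\<gamma>, \<phi>). tensA M \<phi> \<gamma>) \<rparr>),
    BAssoc = (\<lambda>_ _ _ _ h g f. inv_arr (Ground M) (Assoc M f g h)),
    BLUnit = (\<lambda>_ _ f. RUnit M f),
    BRUnit = (\<lambda>_ _ f. LUnit M f) \<rparr>"

definition deloop_action ::
    "('x, 'y) cat \<Rightarrow> ('m, 'f, 'x, 'y) act \<Rightarrow> (unit, 'm, 'f, 'x, 'y) idx"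
  where "deloop_action C a = \<lparr>
    Fib = (\<lambda>_. C),
    Pull = (\<lambda>_ _ m. ActF a m),
    PullN = (\<lambda>_ _ f. ActN a f),
    ThU = (\<lambda>_. ActU a),
    ThC = (\<lambda>_ _ _ m n. ActM a m n) \<rparr>"

text \<open>The functor sending \<open>(X, X')\<close> to \<open>(X, X')\<^sup>A\<close>, with \<open>A\<close> the unique object, and the class
  of \<open>(l, r)\<close> with representative \<open>m\<close> to the class of \<open>(l, r)\<close> with representative \<open>m\<close>.\<close>

definition mixed_to_dependent ::
    "('x \<times> 'z, ('x \<times> 'z) \<times> ('x \<times> 'z) \<times> ('m \<times> 'y \<times> 'w) set,
      unit \<times> 'x \<times> 'z, (unit \<times> 'x \<times> 'z) \<times> (unit \<times> 'x \<times> 'z) \<times> ('m \<times> 'y \<times> 'w) set) ftr"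
  where "mixed_to_dependent = \<lparr>
    OMap = (\<lambda>S. ((), S)),
    AMap = (\<lambda>(S, T, c). (((), S), ((), T), c)) \<rparr>"

end

theory Submission
  imports Defs
begin

text \<open>Reversing the tensor product of a monoidal category inverts the pentagon and triangle
  identities, which turns them into those of a bicategory with one object; the coherence laws of an
  action are then the laws of a pseudofunctor on it. Over this bicategory the hom sets, identities and
  composites of dependent optics are literally those of mixed optics, so the comparison functor only
  relabels arrows. It remains to see that mixed optics form a category: sliding a 2-cell \<open>f\<close> across a
  coend representative becomes sliding \<open>f \<otimes> id\<close> or \<open>id \<otimes> f\<close> across the composite, and the unit and
  associativity laws hold by sliding the unitors and the associator.\<close>

section \<open>Calculations in a category\<close>

text \<open>\<open>iso_of_categories\<close> demands that both sides be categories. The axioms are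
  checked only for mixed optics; dependent optics over the one-object bicategory inherit them along
  the relabelling bijection, so no composition of dependent optics over a general bicategory has to
  be analysed. The obstacle is that equal optics usually have different representatives. To identify
  them, one arrow of the monoidal category must match the left components covariantly and the right
  components contravariantly. Hence the sliding facts about an action come in pairs,
  \<open>cmp_left_...\<close> and \<open>cmp_right_...\<close>. The right members involve inverses
  of the structure isomorphisms, which are given only by the description \<open>inv_arr\<close>. The
  calculus of \<open>inverse_arrows\<close> serves to turn a law of the action into its mirror
  image.\<close>

lemma in_Hom_iff: "f \<in> Hom C X Y \<longleftrightarrow> f \<in> Arr C \<and> Dom C f = X \<and> Cod C f = Y"
  by (simp add: Hom_def)

lemma iso_arrI: "inverse_arrows C f g \<Longrightarrow> iso_arr C f"
  by (auto simp: iso_arr_def)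

context category
begin

text \<open>Typing is split into \<open>Arr\<close>, \<open>Dom\<close> and \<open>Cod\<close>: the
  middle object of a composite does not appear in the term, so the simplifier could not guess it in
  rules stated with \<open>Hom\<close>, whereas it can compute \<open>Dom\<close> and
  \<open>Cod\<close>.\<close>

lemma Id_typing:
  assumes "X \<in> Obj C"
  shows "Id C X \<in> Arr C" "Dom C (Id C X) = X" "Cod C (Id C X) = X"
  using Id_closed[OF assms] by (auto simp: in_Hom_iff)

lemma Comp_typing:
  assumes "f \<in> Arr C" "g \<in> Arr C" "Cod C f = Dom C g"
  shows "g \<cdot> f \<in> Arr C" "Dom C (g \<cdot> f) = Dom C f" "Cod C (g \<cdot> f) = Cod C g"
  using Comp_closed[of f "Dom C f" "Dom C g" g "Cod C g"] assms by (auto simp: in_Hom_iff)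

lemma assoc:
  assumes "f \<in> Arr C" "g \<in> Arr C" "h \<in> Arr C" "Cod C f = Dom C g" "Cod C g = Dom C h"
  shows "(h \<cdot> g) \<cdot> f = h \<cdot> (g \<cdot> f)"
  using assms by (intro Comp_assoc) (auto simp: in_Hom_iff)

lemma Id_Comp: "f \<in> Arr C \<Longrightarrow> Cod C f = Y \<Longrightarrow> Id C Y \<cdot> f = f"
  by (rule Id_left) (auto simp: in_Hom_iff)

lemma Comp_Id: "f \<in> Arr C \<Longrightarrow> Dom C f = X \<Longrightarrow> f \<cdot> Id C X = f"
  by (rule Id_right) (auto simp: in_Hom_iff)

lemmas calc = Id_typing Comp_typing Dom_closed Cod_closed assoc Id_Comp Comp_Id

text \<open>The unit laws of an action only say that a unitor acts as a left inverse of a composite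
  of structure isomorphisms; this lemma upgrades that to being the inverse.\<close>

lemma left_inverse_eq:
  assumes "inverse_arrows C u u'" "g \<in> Hom C (Cod C u) (Dom C u)" "g \<cdot> u = Id C (Dom C u)"
  shows "g = u'"
proof -
  note t = assms(1,2)[unfolded inverse_arrows_def in_Hom_iff]
  have "g = g \<cdot> (u \<cdot> u')"
    using t by (simp add: Comp_Id)
  also have "\<dots> = (g \<cdot> u) \<cdot> u'"
    using t by (intro assoc[symmetric]) auto
  also have "\<dots> = u'"
    using t assms(3) by (simp add: Id_Comp)
  finally show ?thesis .
qed

lemma inverse_arrows_unique: "inverse_arrows C f g \<Longrightarrow> inverse_arrows C f h \<Longrightarrow> g = h"
  by (rule left_inverse_eq) (auto simp: inverse_arrows_def)

lemma inv_arr_eq: "inverse_arrows C f g \<Longrightarrow> inv_arr C f = g"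
  unfolding inv_arr_def by (rule the_equality) (auto intro: inverse_arrows_unique)

lemma inverse_arrows_inv: "iso_arr C f \<Longrightarrow> inverse_arrows C f (inv_arr C f)"
  using inv_arr_eq by (auto simp: iso_arr_def)

lemma inverse_arrows_sym: "inverse_arrows C f g \<Longrightarrow> inverse_arrows C g f"
  by (auto simp: inverse_arrows_def in_Hom_iff)

lemma inverse_cancel:
  assumes "inverse_arrows C g g'" "f \<in> Arr C"
  shows "Cod C f = Dom C g \<Longrightarrow> g' \<cdot> (g \<cdot> f) = f" "Cod C f = Cod C g \<Longrightarrow> g \<cdot> (g' \<cdot> f) = f"
  using assms by (auto simp: inverse_arrows_def in_Hom_iff Id_Comp simp flip: assoc)

lemma inverse_arrows_Comp:
  assumes "inverse_arrows C f f'" "inverse_arrows C g g'" "Cod C f = Dom C g"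
  shows "inverse_arrows C (g \<cdot> f) (f' \<cdot> g')"
  using assms inverse_cancel[OF assms(1), of g'] inverse_cancel[OF assms(2), of f]
  by (simp add: inverse_arrows_def in_Hom_iff Comp_typing assoc)

text \<open>In a commuting square with two opposite sides invertible, these sides may be reversed.
  Naturality and associativity laws for \<open>\<mu>\<close> and \<open>\<epsilon>\<close> pass to
  their inverses in this way.\<close>

lemma inverse_square:
  assumes u: "inverse_arrows C u u'" and v: "inverse_arrows C v v'"
    and f: "f \<in> Hom C (Dom C u) (Dom C v)" and g: "g \<in> Hom C (Cod C u) (Cod C v)"
    and sq: "g \<cdot> u = v \<cdot> f"
  shows "v' \<cdot> g = f \<cdot> u'"
proof -
  note t = u[unfolded inverse_arrows_def in_Hom_iff] v[unfolded inverse_arrows_def in_Hom_iff]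
    f[unfolded in_Hom_iff] g[unfolded in_Hom_iff]
  have "v' \<cdot> g = v' \<cdot> ((g \<cdot> u) \<cdot> u')"
    using t by (simp add: calc)
  also have "\<dots> = v' \<cdot> (v \<cdot> (f \<cdot> u'))"
    unfolding sq using t by (simp add: Comp_typing assoc)
  also have "\<dots> = (v' \<cdot> v) \<cdot> (f \<cdot> u')"
    using t by (intro assoc[symmetric]) (auto simp: Comp_typing)
  also have "\<dots> = f \<cdot> u'"
    using t by (simp add: Comp_typing Id_Comp)
  finally show ?thesis .
qed

end

context cat_functor
begin

lemma AMap_typing:
  assumes "f \<in> Arr C"
  shows "AMap F f \<in> Arr D" "Dom D (AMap F f) = OMap F (Dom C f)" "Cod D (AMap F f) = OMap F (Cod C f)"
  using AMap_closed[of f "Dom C f" "Cod C f"] assms by (auto simp: in_Hom_iff)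

lemma AMap_Comp':
  assumes "f \<in> Arr C" "g \<in> Arr C" "Cod C f = Dom C g"
  shows "AMap F (g \<cdot>\<^bsub>C\<^esub> f) = AMap F g \<cdot>\<^bsub>D\<^esub> AMap F f"
  using assms by (intro AMap_Comp) (auto simp: in_Hom_iff)

lemma AMap_inverse_arrows:
  assumes "inverse_arrows C f g"
  shows "inverse_arrows D (AMap F f) (AMap F g)"
proof -
  note t = assms[unfolded inverse_arrows_def in_Hom_iff]
  show ?thesis
    using t by (simp add: inverse_arrows_def in_Hom_iff AMap_typing flip: AMap_Comp')
      (simp add: AMap_Id C.Dom_closed C.Cod_closed)
qed

end

section \<open>The one-object bicategory\<close>

context monoidal_category
begin

sublocale V: category C by (rule ground_category)
sublocale T: cat_functor "prod_cat C C" C "Tensor M" by (rule tensor_functor)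

lemma tens_closed: "a \<in> Obj C \<Longrightarrow> b \<in> Obj C \<Longrightarrow> a \<otimes> b \<in> Obj C"
  using T.OMap_closed[of "(a, b)"] by (simp add: prod_cat_def obtens_def tensO_def)

lemma artens_closed:
  "f \<in> Hom C a a' \<Longrightarrow> g \<in> Hom C b b' \<Longrightarrow> f \<otimes>\<^sub>a g \<in> Hom C (a \<otimes> b) (a' \<otimes> b')"
  using T.AMap_closed[of "(f, g)" "(a, b)" "(a', b')"]
  by (simp add: prod_cat_def obtens_def tensO_def artens_def tensA_def in_Hom_iff)

lemma artens_typing:
  assumes "f \<in> Arr C" "g \<in> Arr C"
  shows "f \<otimes>\<^sub>a g \<in> Arr C" "Dom C (f \<otimes>\<^sub>a g) = Dom C f \<otimes> Dom C g"
    "Cod C (f \<otimes>\<^sub>a g) = Cod C f \<otimes> Cod C g"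
  using artens_closed[of f "Dom C f" "Cod C f" g "Dom C g" "Cod C g"] assms
  by (auto simp: in_Hom_iff)

lemma artens_Id: "a \<in> Obj C \<Longrightarrow> b \<in> Obj C \<Longrightarrow> Id C a \<otimes>\<^sub>a Id C b = Id C (a \<otimes> b)"
  using T.AMap_Id[of "(a, b)"]
  by (simp add: prod_cat_def obtens_def tensO_def artens_def tensA_def)

text \<open>The interchange law: the tensor is a functor of both variables jointly.\<close>

lemma artens_Comp:
  assumes "f \<in> Arr C" "f' \<in> Arr C" "g \<in> Arr C" "g' \<in> Arr C" "Cod C f = Dom C f'" "Cod C g = Dom C g'"
  shows "(f' \<cdot>\<^bsub>C\<^esub> f) \<otimes>\<^sub>a (g' \<cdot>\<^bsub>C\<^esub> g) = (f' \<otimes>\<^sub>a g') \<cdot>\<^bsub>C\<^esub> (f \<otimes>\<^sub>a g)"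
  using T.AMap_Comp'[of "(f, g)" "(f', g')"] assms
  by (simp add: prod_cat_def artens_def tensA_def)

lemma artens_inverse_arrows:
  assumes "inverse_arrows C f f'" "inverse_arrows C g g'"
  shows "inverse_arrows C (f \<otimes>\<^sub>a g) (f' \<otimes>\<^sub>a g')"
  using assms
  by (simp add: inverse_arrows_def in_Hom_iff artens_typing flip: artens_Comp)
    (simp add: artens_Id V.Dom_closed V.Cod_closed)

lemma assoc_inverse:
  "a \<in> Obj C \<Longrightarrow> b \<in> Obj C \<Longrightarrow> c \<in> Obj C \<Longrightarrow> inverse_arrows C (\<alpha> a b c) (inv_arr C (\<alpha> a b c))"
  by (intro V.inverse_arrows_inv assoc_iso)

lemma inv_assoc_closed:
  assumes "a \<in> Obj C" "b \<in> Obj C" "c \<in> Obj C"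
  shows "inv_arr C (\<alpha> a b c) \<in> Hom C (a \<otimes> (b \<otimes> c)) ((a \<otimes> b) \<otimes> c)"
  using assoc_inverse[OF assms] assoc_closed[OF assms] by (simp add: inverse_arrows_def in_Hom_iff)

lemma inv_assoc_natural:
  assumes f: "f \<in> Hom C a a'" and g: "g \<in> Hom C b b'" and h: "h \<in> Hom C c c'"
  shows "((f \<otimes>\<^sub>a g) \<otimes>\<^sub>a h) \<cdot>\<^bsub>C\<^esub> inv_arr C (\<alpha> a b c) = inv_arr C (\<alpha> a' b' c') \<cdot>\<^bsub>C\<^esub> (f \<otimes>\<^sub>a (g \<otimes>\<^sub>a h))"
proof -
  have obs: "a \<in> Obj C" "b \<in> Obj C" "c \<in> Obj C" "a' \<in> Obj C" "b' \<in> Obj C" "c' \<in> Obj C"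
    using f g h V.Dom_closed V.Cod_closed by (auto simp: in_Hom_iff)
  have "inv_arr C (\<alpha> a' b' c') \<cdot>\<^bsub>C\<^esub> (f \<otimes>\<^sub>a (g \<otimes>\<^sub>a h)) = ((f \<otimes>\<^sub>a g) \<otimes>\<^sub>a h) \<cdot>\<^bsub>C\<^esub> inv_arr C (\<alpha> a b c)"
    by (rule V.inverse_square[OF assoc_inverse assoc_inverse])
      (use assoc_natural[OF f g h, unfolded comp_def] obs f g h in
        \<open>simp_all add: assoc_closed[unfolded in_Hom_iff] in_Hom_iff artens_typing\<close>)
  then show ?thesis ..
qed

text \<open>Both sides of the pentagon are composites of isomorphisms, and uniqueness of inverses
  equates the two reversed composites. With \<open>a, b, c, d\<close> read as
  \<open>f, g, h, k\<close>, this is the pentagon of the bicategory in which \<open>g\<close> after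
  \<open>f\<close> means \<open>f \<otimes> g\<close>.\<close>

lemma inv_pentagon:
  assumes obs: "a \<in> Obj C" "b \<in> Obj C" "c \<in> Obj C" "d \<in> Obj C"
  shows "inv_arr C (\<alpha> (a \<otimes> b) c d) \<cdot>\<^bsub>C\<^esub> inv_arr C (\<alpha> a b (c \<otimes> d))
    = (inv_arr C (\<alpha> a b c) \<otimes>\<^sub>a Id C d) \<cdot>\<^bsub>C\<^esub> inv_arr C (\<alpha> a (b \<otimes> c) d)
      \<cdot>\<^bsub>C\<^esub> (Id C a \<otimes>\<^sub>a inv_arr C (\<alpha> b c d))"
proof -
  have i: "inverse_arrows C (Id C x) (Id C x)" if "x \<in> Obj C" for x
    using that by (simp add: inverse_arrows_def in_Hom_iff V.calc)
  note t = assoc_closed[unfolded in_Hom_iff] V.Id_typing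
  have "inverse_arrows C (\<alpha> a b (c \<otimes> d) \<cdot>\<^bsub>C\<^esub> \<alpha> (a \<otimes> b) c d)
      (inv_arr C (\<alpha> (a \<otimes> b) c d) \<cdot>\<^bsub>C\<^esub> inv_arr C (\<alpha> a b (c \<otimes> d)))"
    using obs by (intro V.inverse_arrows_Comp assoc_inverse) (simp_all add: t tens_closed)
  moreover have "inverse_arrows C
      ((Id C a \<otimes>\<^sub>a \<alpha> b c d) \<cdot>\<^bsub>C\<^esub> \<alpha> a (b \<otimes> c) d \<cdot>\<^bsub>C\<^esub> (\<alpha> a b c \<otimes>\<^sub>a Id C d))
      ((inv_arr C (\<alpha> a b c) \<otimes>\<^sub>a Id C d) \<cdot>\<^bsub>C\<^esub> (inv_arr C (\<alpha> a (b \<otimes> c) d)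
        \<cdot>\<^bsub>C\<^esub> (Id C a \<otimes>\<^sub>a inv_arr C (\<alpha> b c d))))"
    using obs by (intro V.inverse_arrows_Comp assoc_inverse artens_inverse_arrows i)
      (simp_all add: t tens_closed artens_typing V.Comp_typing)
  ultimately have "inv_arr C (\<alpha> (a \<otimes> b) c d) \<cdot>\<^bsub>C\<^esub> inv_arr C (\<alpha> a b (c \<otimes> d))
    = (inv_arr C (\<alpha> a b c) \<otimes>\<^sub>a Id C d) \<cdot>\<^bsub>C\<^esub> (inv_arr C (\<alpha> a (b \<otimes> c) d)
        \<cdot>\<^bsub>C\<^esub> (Id C a \<otimes>\<^sub>a inv_arr C (\<alpha> b c d)))"
    unfolding pentagon[OF obs, unfolded comp_def] by (rule V.inverse_arrows_unique)
  \<comment> \<open>Reversing a left-nested composite produces a right-nested one; the bicategory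
    axiom is stated left-nested.\<close>
  also have "\<dots> = (inv_arr C (\<alpha> a b c) \<otimes>\<^sub>a Id C d) \<cdot>\<^bsub>C\<^esub> inv_arr C (\<alpha> a (b \<otimes> c) d)
        \<cdot>\<^bsub>C\<^esub> (Id C a \<otimes>\<^sub>a inv_arr C (\<alpha> b c d))"
    using obs
    by (intro V.assoc[symmetric])
      (simp_all add: t inv_assoc_closed[unfolded in_Hom_iff] tens_closed artens_typing)
  finally show ?thesis .
qed

text \<open>Precompose the triangle with the inverse associator. The two unitors thereby trade
  places, as the reversed tensor requires.\<close>

lemma inv_triangle:
  assumes obs: "a \<in> Obj C" "b \<in> Obj C"
  shows "(ru a \<otimes>\<^sub>a Id C b) \<cdot>\<^bsub>C\<^esub> inv_arr C (\<alpha> a (Unit M) b) = Id C a \<otimes>\<^sub>a lu b"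
proof -
  note i = assoc_inverse[OF obs(1) unit_closed obs(2), unfolded inverse_arrows_def in_Hom_iff]
  note t = assoc_closed[unfolded in_Hom_iff] lunit_closed[unfolded in_Hom_iff]
  show ?thesis
    unfolding triangle[OF obs, unfolded comp_def, symmetric] using i obs unit_closed
    by (simp add: t V.calc artens_typing)
qed

lemma deloop_hcomp_functor:
  "cat_functor (prod_cat C C) C \<lparr>OMap = \<lambda>(g, f). f \<otimes> g, AMap = \<lambda>(\<gamma>, \<phi>). \<phi> \<otimes>\<^sub>a \<gamma>\<rparr>"
proof (unfold_locales, goal_cases)
  case (2 f X Y)
  then show ?case
    by (cases f; cases X; cases Y) (simp add: prod_cat_def artens_typing in_Hom_iff)
next
  case (4 f X Y g Z)
  then show ?case
    by (cases f; cases g) (auto simp: prod_cat_def in_Hom_iff artens_Comp)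
qed (auto simp: prod_cat_def tens_closed artens_Id)

end

lemma bicategory_deloop:
  assumes "monoidal_category M"
  shows "bicategory (deloop M)"
proof -
  interpret M: monoidal_category M "Ground M" "tensO M" "tensA M" "Comp (Ground M)"
    "Assoc M" "LUnit M" "RUnit M"
    using assms by simp_all
  show ?thesis
  proof (rule bicategory.intro, unfold deloop_def comp1_def comp2_def bicat.simps ftr.simps prod.case, goal_cases)
    case (1 A B) then show ?case by (intro M.ground_category)
  next
    case (2 A) then show ?case by (intro M.unit_closed)
  next
    case (3 A B C) then show ?case by (intro M.deloop_hcomp_functor)
  next
    case 4 then show ?case by (intro M.inv_assoc_closed)
  next
    case 5 then show ?case by (intro M.assoc_inverse[THEN M.V.inverse_arrows_sym, THEN iso_arrI])
  next
    case 6 then show ?case by (intro M.inv_assoc_natural)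
  next
    \<comment> \<open>Composing with the unit 1-cell on the left is tensoring with the unit object
      on the right, so the left unitor axioms are those of \<open>RUnit M\<close>, and
      conversely.\<close>
    case 7 then show ?case by (intro M.runit_closed)
  next
    case 8 then show ?case by (intro M.runit_iso)
  next
    case 9 then show ?case by (intro M.runit_natural)
  next
    case 10 then show ?case by (intro M.lunit_closed)
  next
    case 11 then show ?case by (intro M.lunit_iso)
  next
    case 12 then show ?case by (intro M.lunit_natural)
  next
    case 13 then show ?case by (intro M.inv_pentagon)
  next
    case 14 then show ?case by (intro M.inv_triangle)
  qed
qed

section \<open>Actions\<close>

context action
begin

sublocale M: monoidal_category M V tens "tensA M" "Comp V" "Assoc M" "LUnit M" "RUnit M"
  unfolding V_def tens_def by (rule monoidal) simp_all

text \<open>Extracted from the unit isomorphism, which is a transformation between endofunctors of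
  \<open>C\<close>.\<close>

sublocale cat: category C
  using unit_nat_iso by (simp add: nat_iso_def nat_trans_def cat_functor_def)

lemmas tens_typing = M.artens_typing M.tens_closed M.unit_closed[folded I_def]

lemma ob_closed: "m \<in> Obj V \<Longrightarrow> x \<in> Obj C \<Longrightarrow> m \<odot> x \<in> Obj C"
  unfolding ob_def actO_def by (rule cat_functor.OMap_closed[OF functor_of_object])

lemma ar_typing:
  assumes "m \<in> Obj V" "f \<in> Arr C"
  shows "m \<odot>\<^sub>a f \<in> Arr C" "Dom C (m \<odot>\<^sub>a f) = m \<odot> Dom C f" "Cod C (m \<odot>\<^sub>a f) = m \<odot> Cod C f"
  unfolding ar_def ob_def actA_def actO_def
  using cat_functor.AMap_typing[OF functor_of_object] assms by simp_all

lemma ar_Id: "m \<in> Obj V \<Longrightarrow> x \<in> Obj C \<Longrightarrow> m \<odot>\<^sub>a Id C x = Id C (m \<odot> x)"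
  unfolding ar_def ob_def actA_def actO_def by (rule cat_functor.AMap_Id[OF functor_of_object])

lemma ar_Comp:
  assumes "m \<in> Obj V" "f \<in> Arr C" "g \<in> Arr C" "Cod C f = Dom C g"
  shows "m \<odot>\<^sub>a (g \<cdot>\<^bsub>C\<^esub> f) = (m \<odot>\<^sub>a g) \<cdot>\<^bsub>C\<^esub> (m \<odot>\<^sub>a f)"
  unfolding ar_def actA_def using assms by (intro cat_functor.AMap_Comp'[OF functor_of_object])

lemma ar_inverse_arrows:
  "m \<in> Obj V \<Longrightarrow> inverse_arrows C f g \<Longrightarrow> inverse_arrows C (m \<odot>\<^sub>a f) (m \<odot>\<^sub>a g)"
  unfolding ar_def actA_def by (rule cat_functor.AMap_inverse_arrows[OF functor_of_object])

lemma actN_typing: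
  assumes "f \<in> Arr V" "x \<in> Obj C"
  shows "ActN a f x \<in> Arr C" "Dom C (ActN a f x) = Dom V f \<odot> x" "Cod C (ActN a f x) = Cod V f \<odot> x"
proof -
  have "f \<in> Hom V (Dom V f) (Cod V f)"
    using assms by (simp add: in_Hom_iff)
  from nat_trans.component_closed[OF nat_trans_of_arrow[OF this] assms(2)]
  show "ActN a f x \<in> Arr C" "Dom C (ActN a f x) = Dom V f \<odot> x" "Cod C (ActN a f x) = Cod V f \<odot> x"
    by (auto simp: in_Hom_iff ob_def actO_def)
qed

lemma actN_natural:
  assumes "f \<in> Hom V m n" "l \<in> Arr C"
  shows "(n \<odot>\<^sub>a l) \<cdot>\<^bsub>C\<^esub> ActN a f (Dom C l) = ActN a f (Cod C l) \<cdot>\<^bsub>C\<^esub> (m \<odot>\<^sub>a l)"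
  unfolding ar_def actA_def
  using assms(2) by (intro nat_trans.naturality[OF nat_trans_of_arrow[OF assms(1)]]) (simp add: in_Hom_iff)

lemma unit_inverse: "x \<in> Obj C \<Longrightarrow> inverse_arrows C (\<epsilon> x) (inv_arr C (\<epsilon> x))"
  using nat_iso.component_iso[OF unit_nat_iso] by (rule cat.inverse_arrows_inv)

lemma unit_typing:
  assumes "x \<in> Obj C"
  shows "\<epsilon> x \<in> Arr C" "Dom C (\<epsilon> x) = x" "Cod C (\<epsilon> x) = I \<odot> x"
    "inv_arr C (\<epsilon> x) \<in> Arr C" "Dom C (inv_arr C (\<epsilon> x)) = I \<odot> x" "Cod C (inv_arr C (\<epsilon> x)) = x"
  using unit_inverse[OF assms] nat_trans.component_closed[OF nat_iso.axioms(1)[OF unit_nat_iso] assms]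
  by (auto simp: inverse_arrows_def in_Hom_iff ob_def actO_def id_ftr_def)

lemma unit_natural: "l \<in> Arr C \<Longrightarrow> (I \<odot>\<^sub>a l) \<cdot>\<^bsub>C\<^esub> \<epsilon> (Dom C l) = \<epsilon> (Cod C l) \<cdot>\<^bsub>C\<^esub> l"
  using nat_trans.naturality[OF nat_iso.axioms(1)[OF unit_nat_iso], of l "Dom C l" "Cod C l"]
  by (simp add: in_Hom_iff ar_def actA_def id_ftr_def)

lemma mult_inverse:
  "m \<in> Obj V \<Longrightarrow> n \<in> Obj V \<Longrightarrow> x \<in> Obj C \<Longrightarrow> inverse_arrows C (\<mu> m n x) (inv_arr C (\<mu> m n x))"
  using nat_iso.component_iso[OF mult_nat_iso] by (intro cat.inverse_arrows_inv)

lemma mult_typing: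
  assumes "m \<in> Obj V" "n \<in> Obj V" "x \<in> Obj C"
  shows "\<mu> m n x \<in> Arr C" "Dom C (\<mu> m n x) = m \<odot> n \<odot> x" "Cod C (\<mu> m n x) = (m \<otimes> n) \<odot> x"
    "inv_arr C (\<mu> m n x) \<in> Arr C" "Dom C (inv_arr C (\<mu> m n x)) = (m \<otimes> n) \<odot> x"
    "Cod C (inv_arr C (\<mu> m n x)) = m \<odot> n \<odot> x"
  using mult_inverse[OF assms]
    nat_trans.component_closed[OF nat_iso.axioms(1)[OF mult_nat_iso[OF assms(1,2)]] assms(3)]
  by (auto simp: inverse_arrows_def in_Hom_iff ob_def actO_def comp_ftr_def)

lemma mult_natural_obj:
  assumes "m \<in> Obj V" "n \<in> Obj V" "l \<in> Arr C"
  shows "((m \<otimes> n) \<odot>\<^sub>a l) \<cdot>\<^bsub>C\<^esub> \<mu> m n (Dom C l) = \<mu> m n (Cod C l) \<cdot>\<^bsub>C\<^esub> (m \<odot>\<^sub>a n \<odot>\<^sub>a l)"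
  using nat_trans.naturality[OF nat_iso.axioms(1)[OF mult_nat_iso[OF assms(1,2)]], of l "Dom C l" "Cod C l"]
    assms(3)
  by (simp add: in_Hom_iff ar_def actA_def comp_ftr_def)

section \<open>Actions as indexed categories over the one-object bicategory\<close>

lemma actN_inverse_arrows:
  assumes "inverse_arrows V f g" "x \<in> Obj C"
  shows "inverse_arrows C (ActN a f x) (ActN a g x)"
proof -
  note t = assms(1)[unfolded inverse_arrows_def in_Hom_iff]
  have "ActN a g x \<cdot>\<^bsub>C\<^esub> ActN a f x = Id C (Dom V f \<odot> x)"
    using act_Comp[of f "Dom V f" "Cod V f" g "Dom V f" x] act_Id[of "Dom V f" x] t assms(2)
    by (simp add: in_Hom_iff M.V.Dom_closed comp_def)
  moreover have "ActN a f x \<cdot>\<^bsub>C\<^esub> ActN a g x = Id C (Cod V f \<odot> x)"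
    using act_Comp[of g "Cod V f" "Dom V f" f "Cod V f" x] act_Id[of "Cod V f" x] t assms(2)
    by (simp add: in_Hom_iff M.V.Cod_closed comp_def)
  ultimately show ?thesis
    using t assms(2) by (simp add: inverse_arrows_def in_Hom_iff actN_typing)
qed

lemmas assoc_typing = M.assoc_closed[unfolded in_Hom_iff]

lemmas typing = actN_typing ar_typing mult_typing unit_typing ob_closed tens_typing assoc_typing
  M.lunit_closed[unfolded in_Hom_iff] M.runit_closed[unfolded in_Hom_iff, folded I_def]
  M.V.Id_typing cat.Id_typing cat.Comp_typing

text \<open>The associator of the one-object bicategory is the inverse of \<open>Assoc M\<close>, so
  the hexagon of the action has to be solved for the composite that does not contain the
  associator.\<close>

lemma coherence_assoc_inv:
  assumes obs: "m \<in> Obj V" "n \<in> Obj V" "p \<in> Obj V" "x \<in> Obj C"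
  shows "\<mu> (m \<otimes> n) p x \<cdot>\<^bsub>C\<^esub> \<mu> m n (p \<odot> x)
    = ActN a (inv_arr V (Assoc M m n p)) x \<cdot>\<^bsub>C\<^esub> (\<mu> m (n \<otimes> p) x \<cdot>\<^bsub>C\<^esub> (m \<odot>\<^sub>a \<mu> n p x))"
proof -
  have i: "inverse_arrows C (ActN a (Assoc M m n p) x) (ActN a (inv_arr V (Assoc M m n p)) x)"
    by (intro actN_inverse_arrows M.assoc_inverse obs)
  show ?thesis
    unfolding coherence_assoc[OF obs, unfolded comp_def, symmetric]
    using obs by (intro cat.inverse_cancel(1)[OF i, symmetric]) (simp_all add: typing)
qed

text \<open>With \<open>\<mu> f g\<close> as \<open>\<theta>\<close> for the composable pair
  \<open>f\<close>, \<open>g\<close>, the pseudofunctor laws are the laws of an action read in a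
  different notation. Only the associativity law has to be rearranged, and the two unit laws change
  places together with the unitors.\<close>

lemma indexed_category_deloop_action: "indexed_category (deloop M) (deloop_action C a)"
proof (rule indexed_category.intro,
    unfold deloop_def deloop_action_def comp1_def comp2_def pullO_def pullA_def
      bicat.simps idx.simps ftr.simps prod.case, goal_cases)
  case 1 then show ?case
    using bicategory_deloop[OF monoidal] by (simp add: deloop_def)
next
  case 2 then show ?case by (intro cat.category_axioms)
next
  case 3 then show ?case by (intro functor_of_object[unfolded V_def])
next
  case 4 then show ?case by (intro nat_trans_of_arrow[unfolded V_def])
next
  case 5 then show ?case by (intro act_Id[unfolded V_def ob_def actO_def])
next
  case 6 then show ?case by (intro act_Comp[unfolded V_def comp_def])
next
  case 7 then show ?case using unit_nat_iso by (simp add: I_def \<epsilon>_def)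
next
  case 8 then show ?case using mult_nat_iso by (simp add: V_def tens_def \<mu>_def)
next
  case (9 A B D \<phi> f f' \<gamma> g g' X) then show ?case
    using mult_natural by (simp add: V_def \<mu>_def comp_def actA_def actO_def ob_def ar_def)
next
  case (10 A B D E f g h X) then show ?case
    using coherence_assoc_inv[of f g h X]
    by (simp add: V_def \<mu>_def tens_def actA_def actO_def ob_def ar_def)
next
  case 11 then show ?case
    using coherence_runit by (simp add: V_def \<mu>_def comp_def actA_def actO_def ob_def ar_def \<epsilon>_def I_def)
next
  case 12 then show ?case
    using coherence_lunit by (simp add: V_def \<mu>_def comp_def actA_def actO_def ob_def ar_def \<epsilon>_def I_def)
qed

section \<open>Naturality in one variable and inverted coherence laws\<close>

lemma mult_natural_left:
  assumes f: "f \<in> Hom V m m'" and obs: "n \<in> Obj V" "x \<in> Obj C"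
  shows "ActN a (tensA M f (Id V n)) x \<cdot>\<^bsub>C\<^esub> \<mu> m n x = \<mu> m' n x \<cdot>\<^bsub>C\<^esub> ActN a f (n \<odot> x)"
proof -
  have "m \<in> Obj V"
    using f M.V.Dom_closed by (auto simp: in_Hom_iff)
  then show ?thesis
    using mult_natural[OF f M.V.Id_closed[OF obs(1)] obs(2)] f obs
    by (simp add: act_Id ar_Id comp_def in_Hom_iff typing cat.Comp_Id)
qed

lemma mult_natural_right:
  assumes g: "g \<in> Hom V n n'" and obs: "m \<in> Obj V" "x \<in> Obj C"
  shows "ActN a (tensA M (Id V m) g) x \<cdot>\<^bsub>C\<^esub> \<mu> m n x = \<mu> m n' x \<cdot>\<^bsub>C\<^esub> (m \<odot>\<^sub>a ActN a g x)"
proof -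
  have "n' \<in> Obj V"
    using g M.V.Cod_closed by (auto simp: in_Hom_iff)
  then show ?thesis
    using mult_natural[OF M.V.Id_closed[OF obs(1)] g obs(2)] g obs
    by (simp add: act_Id comp_def in_Hom_iff typing cat.Id_Comp)
qed

text \<open>The right component of a composite optic contains the inverse of \<open>\<mu>\<close>,
  so sliding there needs the naturality square reversed.\<close>

lemma inv_mult_natural_left:
  assumes f: "f \<in> Hom V m m'" and obs: "n \<in> Obj V" "x \<in> Obj C"
  shows "inv_arr C (\<mu> m' n x) \<cdot>\<^bsub>C\<^esub> ActN a (tensA M f (Id V n)) x
    = ActN a f (n \<odot> x) \<cdot>\<^bsub>C\<^esub> inv_arr C (\<mu> m n x)"
proof -
  have o: "m \<in> Obj V" "m' \<in> Obj V"
    using f M.V.Dom_closed M.V.Cod_closed by (auto simp: in_Hom_iff)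
  show ?thesis
    by (rule cat.inverse_square[OF mult_inverse mult_inverse _ _ mult_natural_left[OF f obs]])
      (use f obs o in \<open>simp_all add: in_Hom_iff typing\<close>)
qed

lemma inv_mult_natural_right:
  assumes g: "g \<in> Hom V n n'" and obs: "m \<in> Obj V" "x \<in> Obj C"
  shows "inv_arr C (\<mu> m n' x) \<cdot>\<^bsub>C\<^esub> ActN a (tensA M (Id V m) g) x
    = (m \<odot>\<^sub>a ActN a g x) \<cdot>\<^bsub>C\<^esub> inv_arr C (\<mu> m n x)"
proof -
  have o: "n \<in> Obj V" "n' \<in> Obj V"
    using g M.V.Dom_closed M.V.Cod_closed by (auto simp: in_Hom_iff)
  show ?thesis
    by (rule cat.inverse_square[OF mult_inverse mult_inverse _ _ mult_natural_right[OF g obs]])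
      (use g obs o in \<open>simp_all add: in_Hom_iff typing\<close>)
qed

lemma inv_mult_natural_obj:
  assumes obs: "m \<in> Obj V" "n \<in> Obj V" and l: "l \<in> Arr C"
  shows "inv_arr C (\<mu> m n (Cod C l)) \<cdot>\<^bsub>C\<^esub> ((m \<otimes> n) \<odot>\<^sub>a l)
    = (m \<odot>\<^sub>a n \<odot>\<^sub>a l) \<cdot>\<^bsub>C\<^esub> inv_arr C (\<mu> m n (Dom C l))"
  by (rule cat.inverse_square[OF mult_inverse mult_inverse _ _ mult_natural_obj[OF obs l]])
    (use obs l in \<open>simp_all add: in_Hom_iff typing cat.Dom_closed cat.Cod_closed\<close>)

lemma inv_coherence_assoc:
  assumes obs: "m \<in> Obj V" "n \<in> Obj V" "p \<in> Obj V" "x \<in> Obj C"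
  shows "(m \<odot>\<^sub>a inv_arr C (\<mu> n p x)) \<cdot>\<^bsub>C\<^esub> (inv_arr C (\<mu> m (n \<otimes> p) x) \<cdot>\<^bsub>C\<^esub> ActN a (Assoc M m n p) x)
    = inv_arr C (\<mu> m n (p \<odot> x)) \<cdot>\<^bsub>C\<^esub> inv_arr C (\<mu> (m \<otimes> n) p x)"
proof -
  \<comment> \<open>The associativity coherence is read as a square whose sides \<open>u\<close> and
    \<open>v\<close> are the two composites of multiplications and whose fourth side is an identity;
    that identity is written out so that \<open>inverse_square\<close> applies.\<close>
  have "((m \<odot>\<^sub>a inv_arr C (\<mu> n p x)) \<cdot>\<^bsub>C\<^esub> inv_arr C (\<mu> m (n \<otimes> p) x)) \<cdot>\<^bsub>C\<^esub> ActN a (Assoc M m n p) x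
    = Id C (m \<odot> n \<odot> p \<odot> x) \<cdot>\<^bsub>C\<^esub> (inv_arr C (\<mu> m n (p \<odot> x)) \<cdot>\<^bsub>C\<^esub> inv_arr C (\<mu> (m \<otimes> n) p x))"
    by (rule cat.inverse_square[OF cat.inverse_arrows_Comp[OF mult_inverse mult_inverse]
          cat.inverse_arrows_Comp[OF ar_inverse_arrows[OF _ mult_inverse] mult_inverse]])
      (use obs coherence_assoc[OF obs] in
        \<open>simp_all add: in_Hom_iff typing comp_def cat.Comp_Id\<close>)
  then show ?thesis
    using obs by (simp add: typing cat.assoc cat.Id_Comp)
qed

text \<open>The unit coherence makes the acting unitor a left inverse of the isomorphism
  \<open>\<mu>\<close> after \<open>\<epsilon>\<close>, hence its inverse. Right components involve
  the unitor in this solved form.\<close>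

lemma inv_coherence_lunit:
  assumes obs: "m \<in> Obj V" "x \<in> Obj C"
  shows "ActN a (LUnit M m) x = inv_arr C (\<epsilon> (m \<odot> x)) \<cdot>\<^bsub>C\<^esub> inv_arr C (\<mu> I m x)"
  by (rule cat.left_inverse_eq[OF cat.inverse_arrows_Comp[OF unit_inverse mult_inverse]])
    (use obs coherence_lunit[OF obs] in
      \<open>simp_all add: in_Hom_iff typing comp_def I_def[symmetric]\<close>)

lemma inv_coherence_runit:
  assumes obs: "m \<in> Obj V" "x \<in> Obj C"
  shows "ActN a (RUnit M m) x = (m \<odot>\<^sub>a inv_arr C (\<epsilon> x)) \<cdot>\<^bsub>C\<^esub> inv_arr C (\<mu> m I x)"
  by (rule cat.left_inverse_eq
      [OF cat.inverse_arrows_Comp[OF ar_inverse_arrows[OF _ unit_inverse] mult_inverse]])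
    (use obs coherence_runit[OF obs] in
      \<open>simp_all add: in_Hom_iff typing comp_def I_def[symmetric]\<close>)

section \<open>Components of composite optics under sliding\<close>

lemma cmp_left_natural1:
  assumes f: "f \<in> Hom V m m'" and n: "n \<in> Obj V" and z: "z \<in> Obj C"
    and l: "l1 \<in> Hom C x (m \<odot> y)" "l2 \<in> Hom C y (n \<odot> z)"
  shows "ActN a (tensA M f (Id V n)) z \<cdot>\<^bsub>C\<^esub> (\<mu> m n z \<cdot>\<^bsub>C\<^esub> ((m \<odot>\<^sub>a l2) \<cdot>\<^bsub>C\<^esub> l1))
    = \<mu> m' n z \<cdot>\<^bsub>C\<^esub> ((m' \<odot>\<^sub>a l2) \<cdot>\<^bsub>C\<^esub> (ActN a f y \<cdot>\<^bsub>C\<^esub> l1))"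
proof -
  have o: "m \<in> Obj V" "m' \<in> Obj V" "y \<in> Obj C"
    using f l M.V.Dom_closed M.V.Cod_closed cat.Dom_closed by (auto simp: in_Hom_iff)
  note t = f[unfolded in_Hom_iff] n z l[unfolded in_Hom_iff] o
  have "ActN a (tensA M f (Id V n)) z \<cdot>\<^bsub>C\<^esub> (\<mu> m n z \<cdot>\<^bsub>C\<^esub> ((m \<odot>\<^sub>a l2) \<cdot>\<^bsub>C\<^esub> l1))
    = (ActN a (tensA M f (Id V n)) z \<cdot>\<^bsub>C\<^esub> \<mu> m n z) \<cdot>\<^bsub>C\<^esub> ((m \<odot>\<^sub>a l2) \<cdot>\<^bsub>C\<^esub> l1)"
    using t by (simp add: typing cat.assoc)
  also have "\<dots> = \<mu> m' n z \<cdot>\<^bsub>C\<^esub> ((ActN a f (n \<odot> z) \<cdot>\<^bsub>C\<^esub> (m \<odot>\<^sub>a l2)) \<cdot>\<^bsub>C\<^esub> l1)"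
    unfolding mult_natural_left[OF f n z] using t by (simp add: typing cat.assoc)
  \<comment> \<open>After passing \<open>\<mu>\<close>, the arrow \<open>f\<close> acts outside the
    image of \<open>l2\<close>; naturality of its action in the object carries it across to
    \<open>l1\<close>.\<close>
  also have "ActN a f (n \<odot> z) \<cdot>\<^bsub>C\<^esub> (m \<odot>\<^sub>a l2) = (m' \<odot>\<^sub>a l2) \<cdot>\<^bsub>C\<^esub> ActN a f y"
    using actN_natural[OF f, of l2] t by simp
  also have "\<dots> \<cdot>\<^bsub>C\<^esub> l1 = (m' \<odot>\<^sub>a l2) \<cdot>\<^bsub>C\<^esub> (ActN a f y \<cdot>\<^bsub>C\<^esub> l1)"
    using t by (simp add: typing cat.assoc)
  finally show ?thesis .
qed

text \<open>Here \<open>g\<close> comes out of \<open>\<mu>\<close> inside the functor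
  \<open>m \<odot> _\<close>, next to the image of \<open>l2\<close>, so functoriality alone absorbs
  it into \<open>l2\<close>.\<close>

lemma cmp_left_natural2:
  assumes g: "g \<in> Hom V n n'" and m: "m \<in> Obj V" and z: "z \<in> Obj C"
    and l: "l1 \<in> Hom C x (m \<odot> y)" "l2 \<in> Hom C y (n \<odot> z)"
  shows "ActN a (tensA M (Id V m) g) z \<cdot>\<^bsub>C\<^esub> (\<mu> m n z \<cdot>\<^bsub>C\<^esub> ((m \<odot>\<^sub>a l2) \<cdot>\<^bsub>C\<^esub> l1))
    = \<mu> m n' z \<cdot>\<^bsub>C\<^esub> ((m \<odot>\<^sub>a (ActN a g z \<cdot>\<^bsub>C\<^esub> l2)) \<cdot>\<^bsub>C\<^esub> l1)"
proof -
  have o: "n \<in> Obj V" "n' \<in> Obj V" "y \<in> Obj C"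
    using g l M.V.Dom_closed M.V.Cod_closed cat.Dom_closed by (auto simp: in_Hom_iff)
  note t = g[unfolded in_Hom_iff] m z l[unfolded in_Hom_iff] o
  have "ActN a (tensA M (Id V m) g) z \<cdot>\<^bsub>C\<^esub> (\<mu> m n z \<cdot>\<^bsub>C\<^esub> ((m \<odot>\<^sub>a l2) \<cdot>\<^bsub>C\<^esub> l1))
    = (ActN a (tensA M (Id V m) g) z \<cdot>\<^bsub>C\<^esub> \<mu> m n z) \<cdot>\<^bsub>C\<^esub> ((m \<odot>\<^sub>a l2) \<cdot>\<^bsub>C\<^esub> l1)"
    using t by (simp add: typing cat.assoc)
  also have "\<dots> = \<mu> m n' z \<cdot>\<^bsub>C\<^esub> ((m \<odot>\<^sub>a (ActN a g z \<cdot>\<^bsub>C\<^esub> l2)) \<cdot>\<^bsub>C\<^esub> l1)"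
    unfolding mult_natural_right[OF g m z] using t by (simp add: typing cat.assoc ar_Comp)
  finally show ?thesis .
qed

text \<open>Mirror image of the left component: \<open>f\<close> enters at the source and is pushed
  through the inverse of \<open>\<mu>\<close> and the image of \<open>r2\<close> until it reaches
  \<open>r1\<close>.\<close>

lemma cmp_right_natural1:
  assumes f: "f \<in> Hom V m m'" and n: "n \<in> Obj V" and z: "z \<in> Obj C"
    and r: "r1 \<in> Hom C (m' \<odot> y) x" "r2 \<in> Hom C (n \<odot> z) y"
  shows "(r1 \<cdot>\<^bsub>C\<^esub> ((m' \<odot>\<^sub>a r2) \<cdot>\<^bsub>C\<^esub> inv_arr C (\<mu> m' n z))) \<cdot>\<^bsub>C\<^esub> ActN a (tensA M f (Id V n)) z
    = (r1 \<cdot>\<^bsub>C\<^esub> ActN a f y) \<cdot>\<^bsub>C\<^esub> ((m \<odot>\<^sub>a r2) \<cdot>\<^bsub>C\<^esub> inv_arr C (\<mu> m n z))"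
proof -
  have o: "m \<in> Obj V" "m' \<in> Obj V" "y \<in> Obj C"
    using f r M.V.Dom_closed M.V.Cod_closed cat.Cod_closed by (auto simp: in_Hom_iff)
  note t = f[unfolded in_Hom_iff] n z r[unfolded in_Hom_iff] o
  have "(r1 \<cdot>\<^bsub>C\<^esub> ((m' \<odot>\<^sub>a r2) \<cdot>\<^bsub>C\<^esub> inv_arr C (\<mu> m' n z))) \<cdot>\<^bsub>C\<^esub> ActN a (tensA M f (Id V n)) z
    = r1 \<cdot>\<^bsub>C\<^esub> ((m' \<odot>\<^sub>a r2) \<cdot>\<^bsub>C\<^esub> (inv_arr C (\<mu> m' n z) \<cdot>\<^bsub>C\<^esub> ActN a (tensA M f (Id V n)) z))"
    using t by (simp add: typing cat.assoc)
  also have "\<dots> = r1 \<cdot>\<^bsub>C\<^esub> (((m' \<odot>\<^sub>a r2) \<cdot>\<^bsub>C\<^esub> ActN a f (n \<odot> z)) \<cdot>\<^bsub>C\<^esub> inv_arr C (\<mu> m n z))"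
    unfolding inv_mult_natural_left[OF f n z] using t by (simp add: typing cat.assoc)
  also have "(m' \<odot>\<^sub>a r2) \<cdot>\<^bsub>C\<^esub> ActN a f (n \<odot> z) = ActN a f y \<cdot>\<^bsub>C\<^esub> (m \<odot>\<^sub>a r2)"
    using actN_natural[OF f, of r2] t by simp
  also have "r1 \<cdot>\<^bsub>C\<^esub> (\<dots> \<cdot>\<^bsub>C\<^esub> inv_arr C (\<mu> m n z))
    = (r1 \<cdot>\<^bsub>C\<^esub> ActN a f y) \<cdot>\<^bsub>C\<^esub> ((m \<odot>\<^sub>a r2) \<cdot>\<^bsub>C\<^esub> inv_arr C (\<mu> m n z))"
    using t by (simp add: typing cat.assoc)
  finally show ?thesis .
qed

lemma cmp_right_natural2:
  assumes g: "g \<in> Hom V n n'" and m: "m \<in> Obj V" and z: "z \<in> Obj C"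
    and r: "r1 \<in> Hom C (m \<odot> y) x" "r2 \<in> Hom C (n' \<odot> z) y"
  shows "(r1 \<cdot>\<^bsub>C\<^esub> ((m \<odot>\<^sub>a r2) \<cdot>\<^bsub>C\<^esub> inv_arr C (\<mu> m n' z))) \<cdot>\<^bsub>C\<^esub> ActN a (tensA M (Id V m) g) z
    = r1 \<cdot>\<^bsub>C\<^esub> ((m \<odot>\<^sub>a (r2 \<cdot>\<^bsub>C\<^esub> ActN a g z)) \<cdot>\<^bsub>C\<^esub> inv_arr C (\<mu> m n z))"
proof -
  have o: "n \<in> Obj V" "n' \<in> Obj V" "y \<in> Obj C"
    using g r M.V.Dom_closed M.V.Cod_closed cat.Cod_closed by (auto simp: in_Hom_iff)
  note t = g[unfolded in_Hom_iff] m z r[unfolded in_Hom_iff] o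
  have "(r1 \<cdot>\<^bsub>C\<^esub> ((m \<odot>\<^sub>a r2) \<cdot>\<^bsub>C\<^esub> inv_arr C (\<mu> m n' z))) \<cdot>\<^bsub>C\<^esub> ActN a (tensA M (Id V m) g) z
    = r1 \<cdot>\<^bsub>C\<^esub> ((m \<odot>\<^sub>a r2) \<cdot>\<^bsub>C\<^esub> (inv_arr C (\<mu> m n' z) \<cdot>\<^bsub>C\<^esub> ActN a (tensA M (Id V m) g) z))"
    using t by (simp add: typing cat.assoc)
  also have "\<dots> = r1 \<cdot>\<^bsub>C\<^esub> ((m \<odot>\<^sub>a (r2 \<cdot>\<^bsub>C\<^esub> ActN a g z)) \<cdot>\<^bsub>C\<^esub> inv_arr C (\<mu> m n z))"
    unfolding inv_mult_natural_right[OF g m z] using t by (simp add: typing cat.assoc ar_Comp)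
  finally show ?thesis .
qed

text \<open>Composing with an identity optic in first position inserts \<open>\<epsilon> x\<close>.
  Naturality of \<open>\<epsilon>\<close> moves it past \<open>l\<close>, where it meets
  \<open>\<mu>\<close> and the unitor and all three cancel.\<close>

lemma cmp_left_lunit:
  assumes "m \<in> Obj V" "y \<in> Obj C" "l \<in> Hom C x (m \<odot> y)"
  shows "ActN a (LUnit M m) y \<cdot>\<^bsub>C\<^esub> (\<mu> I m y \<cdot>\<^bsub>C\<^esub> ((I \<odot>\<^sub>a l) \<cdot>\<^bsub>C\<^esub> \<epsilon> x)) = l"
proof -
  have o: "x \<in> Obj C" "I \<in> Obj V"
    using assms cat.Dom_closed M.unit_closed by (auto simp: in_Hom_iff I_def)
  note t = assms(1,2) assms(3)[unfolded in_Hom_iff] o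
  have "(I \<odot>\<^sub>a l) \<cdot>\<^bsub>C\<^esub> \<epsilon> x = \<epsilon> (m \<odot> y) \<cdot>\<^bsub>C\<^esub> l"
    using unit_natural[of l] t by simp
  then have "ActN a (LUnit M m) y \<cdot>\<^bsub>C\<^esub> (\<mu> I m y \<cdot>\<^bsub>C\<^esub> ((I \<odot>\<^sub>a l) \<cdot>\<^bsub>C\<^esub> \<epsilon> x))
    = (ActN a (LUnit M m) y \<cdot>\<^bsub>C\<^esub> (\<mu> I m y \<cdot>\<^bsub>C\<^esub> \<epsilon> (m \<odot> y))) \<cdot>\<^bsub>C\<^esub> l"
    using t by (simp add: typing cat.assoc I_def[symmetric])
  also have "\<dots> = l"
    unfolding coherence_lunit[OF assms(1,2), unfolded comp_def] using t by (simp add: cat.Id_Comp)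
  finally show ?thesis .
qed

lemma cmp_left_runit:
  assumes "m \<in> Obj V" "y \<in> Obj C" "l \<in> Hom C x (m \<odot> y)"
  shows "ActN a (RUnit M m) y \<cdot>\<^bsub>C\<^esub> (\<mu> m I y \<cdot>\<^bsub>C\<^esub> ((m \<odot>\<^sub>a \<epsilon> y) \<cdot>\<^bsub>C\<^esub> l)) = l"
proof -
  have o: "I \<in> Obj V"
    using M.unit_closed by (auto simp: I_def)
  note t = assms(1,2) assms(3)[unfolded in_Hom_iff] o
  have "ActN a (RUnit M m) y \<cdot>\<^bsub>C\<^esub> (\<mu> m I y \<cdot>\<^bsub>C\<^esub> ((m \<odot>\<^sub>a \<epsilon> y) \<cdot>\<^bsub>C\<^esub> l))
    = (ActN a (RUnit M m) y \<cdot>\<^bsub>C\<^esub> (\<mu> m I y \<cdot>\<^bsub>C\<^esub> (m \<odot>\<^sub>a \<epsilon> y))) \<cdot>\<^bsub>C\<^esub> l"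
    using t by (simp add: typing cat.assoc I_def[symmetric])
  also have "\<dots> = l"
    unfolding coherence_runit[OF assms(1,2), unfolded comp_def] using t by (simp add: cat.Id_Comp)
  finally show ?thesis .
qed

text \<open>The unitor stays on the right-hand side because a coend step identifies \<open>r\<close>
  precomposed with the acting arrow at its source with \<open>r\<close> at its target.\<close>

lemma cmp_right_lunit:
  assumes "m \<in> Obj V" "y \<in> Obj C" "r \<in> Hom C (m \<odot> y) x"
  shows "inv_arr C (\<epsilon> x) \<cdot>\<^bsub>C\<^esub> ((I \<odot>\<^sub>a r) \<cdot>\<^bsub>C\<^esub> inv_arr C (\<mu> I m y)) = r \<cdot>\<^bsub>C\<^esub> ActN a (LUnit M m) y"
proof -
  have o: "x \<in> Obj C" "I \<in> Obj V"
    using assms cat.Cod_closed M.unit_closed by (auto simp: in_Hom_iff I_def)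
  note t = assms(1,2) assms(3)[unfolded in_Hom_iff] o
  have "inv_arr C (\<epsilon> x) \<cdot>\<^bsub>C\<^esub> (I \<odot>\<^sub>a r) = r \<cdot>\<^bsub>C\<^esub> inv_arr C (\<epsilon> (m \<odot> y))"
    by (rule cat.inverse_square[OF unit_inverse unit_inverse])
      (use t unit_natural[of r] in \<open>simp_all add: in_Hom_iff typing\<close>)
  then have "(inv_arr C (\<epsilon> x) \<cdot>\<^bsub>C\<^esub> (I \<odot>\<^sub>a r)) \<cdot>\<^bsub>C\<^esub> inv_arr C (\<mu> I m y)
    = (r \<cdot>\<^bsub>C\<^esub> inv_arr C (\<epsilon> (m \<odot> y))) \<cdot>\<^bsub>C\<^esub> inv_arr C (\<mu> I m y)"
    by simp
  then show ?thesis
    using t by (simp add: typing cat.assoc inv_coherence_lunit)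
qed

lemma cmp_right_runit:
  assumes "m \<in> Obj V" "y \<in> Obj C" "r \<in> Hom C (m \<odot> y) x"
  shows "r \<cdot>\<^bsub>C\<^esub> ((m \<odot>\<^sub>a inv_arr C (\<epsilon> y)) \<cdot>\<^bsub>C\<^esub> inv_arr C (\<mu> m I y)) = r \<cdot>\<^bsub>C\<^esub> ActN a (RUnit M m) y"
  using assms by (simp add: inv_coherence_runit)

text \<open>Naturality of \<open>\<mu> m n\<close> in the object brings the two multiplications
  together; the coherence law then replaces them and the associator, and functoriality of
  \<open>m \<odot> _\<close> regroups the rest.\<close>

lemma cmp_left_assoc:
  assumes obs: "m \<in> Obj V" "n \<in> Obj V" "p \<in> Obj V" "w \<in> Obj C"
    and l: "l1 \<in> Hom C x (m \<odot> y)" "l2 \<in> Hom C y (n \<odot> z)" "l3 \<in> Hom C z (p \<odot> w)"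
  shows "ActN a (Assoc M m n p) w \<cdot>\<^bsub>C\<^esub> (\<mu> (m \<otimes> n) p w \<cdot>\<^bsub>C\<^esub>
      (((m \<otimes> n) \<odot>\<^sub>a l3) \<cdot>\<^bsub>C\<^esub> (\<mu> m n z \<cdot>\<^bsub>C\<^esub> ((m \<odot>\<^sub>a l2) \<cdot>\<^bsub>C\<^esub> l1))))
    = \<mu> m (n \<otimes> p) w \<cdot>\<^bsub>C\<^esub> ((m \<odot>\<^sub>a (\<mu> n p w \<cdot>\<^bsub>C\<^esub> ((n \<odot>\<^sub>a l3) \<cdot>\<^bsub>C\<^esub> l2))) \<cdot>\<^bsub>C\<^esub> l1)"
proof -
  have o: "y \<in> Obj C" "z \<in> Obj C"
    using l cat.Dom_closed by (auto simp: in_Hom_iff)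
  note t = obs o l[unfolded in_Hom_iff]
  have "ActN a (Assoc M m n p) w \<cdot>\<^bsub>C\<^esub> (\<mu> (m \<otimes> n) p w \<cdot>\<^bsub>C\<^esub>
      (((m \<otimes> n) \<odot>\<^sub>a l3) \<cdot>\<^bsub>C\<^esub> (\<mu> m n z \<cdot>\<^bsub>C\<^esub> ((m \<odot>\<^sub>a l2) \<cdot>\<^bsub>C\<^esub> l1))))
    = ActN a (Assoc M m n p) w \<cdot>\<^bsub>C\<^esub> (\<mu> (m \<otimes> n) p w \<cdot>\<^bsub>C\<^esub>
      ((((m \<otimes> n) \<odot>\<^sub>a l3) \<cdot>\<^bsub>C\<^esub> \<mu> m n z) \<cdot>\<^bsub>C\<^esub> ((m \<odot>\<^sub>a l2) \<cdot>\<^bsub>C\<^esub> l1)))"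
    using t by (simp add: typing cat.assoc)
  also have "((m \<otimes> n) \<odot>\<^sub>a l3) \<cdot>\<^bsub>C\<^esub> \<mu> m n z = \<mu> m n (p \<odot> w) \<cdot>\<^bsub>C\<^esub> (m \<odot>\<^sub>a n \<odot>\<^sub>a l3)"
    using mult_natural_obj[of m n l3] t by simp
  also have "ActN a (Assoc M m n p) w \<cdot>\<^bsub>C\<^esub> (\<mu> (m \<otimes> n) p w \<cdot>\<^bsub>C\<^esub> (\<dots> \<cdot>\<^bsub>C\<^esub> ((m \<odot>\<^sub>a l2) \<cdot>\<^bsub>C\<^esub> l1)))
    = (ActN a (Assoc M m n p) w \<cdot>\<^bsub>C\<^esub> (\<mu> (m \<otimes> n) p w \<cdot>\<^bsub>C\<^esub> \<mu> m n (p \<odot> w)))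
      \<cdot>\<^bsub>C\<^esub> ((m \<odot>\<^sub>a n \<odot>\<^sub>a l3) \<cdot>\<^bsub>C\<^esub> ((m \<odot>\<^sub>a l2) \<cdot>\<^bsub>C\<^esub> l1))"
    using t by (simp add: typing cat.assoc)
  also have "\<dots> = \<mu> m (n \<otimes> p) w \<cdot>\<^bsub>C\<^esub> ((m \<odot>\<^sub>a (\<mu> n p w \<cdot>\<^bsub>C\<^esub> ((n \<odot>\<^sub>a l3) \<cdot>\<^bsub>C\<^esub> l2))) \<cdot>\<^bsub>C\<^esub> l1)"
    unfolding coherence_assoc[OF obs, unfolded comp_def] using t
    by (simp add: typing cat.assoc ar_Comp)
  finally show ?thesis .
qed

lemma cmp_right_assoc:
  assumes obs: "m \<in> Obj V" "n \<in> Obj V" "p \<in> Obj V" "w \<in> Obj C"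
    and r: "r1 \<in> Hom C (m \<odot> y) x" "r2 \<in> Hom C (n \<odot> z) y" "r3 \<in> Hom C (p \<odot> w) z"
  shows "(r1 \<cdot>\<^bsub>C\<^esub> ((m \<odot>\<^sub>a r2) \<cdot>\<^bsub>C\<^esub> inv_arr C (\<mu> m n z))) \<cdot>\<^bsub>C\<^esub>
      (((m \<otimes> n) \<odot>\<^sub>a r3) \<cdot>\<^bsub>C\<^esub> inv_arr C (\<mu> (m \<otimes> n) p w))
    = (r1 \<cdot>\<^bsub>C\<^esub> ((m \<odot>\<^sub>a (r2 \<cdot>\<^bsub>C\<^esub> ((n \<odot>\<^sub>a r3) \<cdot>\<^bsub>C\<^esub> inv_arr C (\<mu> n p w))))
      \<cdot>\<^bsub>C\<^esub> inv_arr C (\<mu> m (n \<otimes> p) w))) \<cdot>\<^bsub>C\<^esub> ActN a (Assoc M m n p) w"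
proof -
  have o: "y \<in> Obj C" "z \<in> Obj C"
    using r cat.Cod_closed by (auto simp: in_Hom_iff)
  note t = obs o r[unfolded in_Hom_iff]
  have "(r1 \<cdot>\<^bsub>C\<^esub> ((m \<odot>\<^sub>a r2) \<cdot>\<^bsub>C\<^esub> inv_arr C (\<mu> m n z))) \<cdot>\<^bsub>C\<^esub>
      (((m \<otimes> n) \<odot>\<^sub>a r3) \<cdot>\<^bsub>C\<^esub> inv_arr C (\<mu> (m \<otimes> n) p w))
    = r1 \<cdot>\<^bsub>C\<^esub> ((m \<odot>\<^sub>a r2) \<cdot>\<^bsub>C\<^esub> ((inv_arr C (\<mu> m n z) \<cdot>\<^bsub>C\<^esub> ((m \<otimes> n) \<odot>\<^sub>a r3))
      \<cdot>\<^bsub>C\<^esub> inv_arr C (\<mu> (m \<otimes> n) p w)))"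
    using t by (simp add: typing cat.assoc)
  also have "inv_arr C (\<mu> m n z) \<cdot>\<^bsub>C\<^esub> ((m \<otimes> n) \<odot>\<^sub>a r3)
    = (m \<odot>\<^sub>a n \<odot>\<^sub>a r3) \<cdot>\<^bsub>C\<^esub> inv_arr C (\<mu> m n (p \<odot> w))"
    using inv_mult_natural_obj[of m n r3] t by simp
  also have "r1 \<cdot>\<^bsub>C\<^esub> ((m \<odot>\<^sub>a r2) \<cdot>\<^bsub>C\<^esub> (\<dots> \<cdot>\<^bsub>C\<^esub> inv_arr C (\<mu> (m \<otimes> n) p w)))
    = r1 \<cdot>\<^bsub>C\<^esub> ((m \<odot>\<^sub>a r2) \<cdot>\<^bsub>C\<^esub> ((m \<odot>\<^sub>a n \<odot>\<^sub>a r3) \<cdot>\<^bsub>C\<^esub>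
      (inv_arr C (\<mu> m n (p \<odot> w)) \<cdot>\<^bsub>C\<^esub> inv_arr C (\<mu> (m \<otimes> n) p w))))"
    using t by (simp add: typing cat.assoc)
  also have "\<dots> = (r1 \<cdot>\<^bsub>C\<^esub> ((m \<odot>\<^sub>a (r2 \<cdot>\<^bsub>C\<^esub> ((n \<odot>\<^sub>a r3) \<cdot>\<^bsub>C\<^esub> inv_arr C (\<mu> n p w))))
      \<cdot>\<^bsub>C\<^esub> inv_arr C (\<mu> m (n \<otimes> p) w))) \<cdot>\<^bsub>C\<^esub> ActN a (Assoc M m n p) w"
    unfolding inv_coherence_assoc[OF obs, symmetric] using t
    by (simp add: typing cat.assoc ar_Comp)
  finally show ?thesis .
qed

end

section \<open>The category of mixed optics\<close>

lemma coend_class_eqI: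
  assumes "equivclp (coend_step D P P\<^sub>a) p q"
  shows "coend_class D P P\<^sub>a p = coend_class D P P\<^sub>a q"
  using assms unfolding coend_class_def by (blast intro: equivclp_sym equivclp_trans)

lemma coend_class_self: "p \<in> (SIGMA m:Obj D. P m m) \<Longrightarrow> p \<in> coend_class D P P\<^sub>a p"
  by (simp add: coend_class_def)

text \<open>The universal property of the coend as a quotient: a function that does not distinguish
  the two ends of a generating step is constant on each class.\<close>

lemma coend_class_respects:
  assumes "q \<in> coend_class D P P\<^sub>a p"
    and "\<And>p q. coend_step D P P\<^sub>a p q \<Longrightarrow> F p = F q"
  shows "F q = F p"
proof -
  have "equivclp (coend_step D P P\<^sub>a) p q"
    using assms(1) by (simp add: coend_class_def)
  then show ?thesis
    by (induction rule: equivclp_induct) (auto dest: assms(2))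
qed

section \<open>Representatives and sliding steps\<close>

locale mixed_actions =
  fixes M :: "('m, 'f) mon"
    and CL :: "('x, 'y) cat" and CR :: "('z, 'w) cat"
    and aL :: "('m, 'f, 'x, 'y) act" and aR :: "('m, 'f, 'z, 'w) act"
  assumes left_action: "action M CL aL" and right_action: "action M CR aR"
begin

sublocale L: action M CL aL "Ground M" "Unit M" "Comp CL" "actO aL" "actA aL" "tensO M" "ActU aL" "ActM aL"
  by (rule left_action) simp_all

sublocale R: action M CR aR "Ground M" "Unit M" "Comp CR" "actO aR" "actA aR" "tensO M" "ActU aR" "ActM aR"
  by (rule right_action) simp_all

definition reps :: "'x \<times> 'z \<Rightarrow> 'x \<times> 'z \<Rightarrow> ('m \<times> 'y \<times> 'w) set"
  where "reps S T = (SIGMA m:Obj (Ground M). mixed_set CL CR aL aR S T m m)"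

abbreviation cls :: "'x \<times> 'z \<Rightarrow> 'x \<times> 'z \<Rightarrow> 'm \<times> 'y \<times> 'w \<Rightarrow> ('m \<times> 'y \<times> 'w) set"
  where "cls \<equiv> mixed_class M CL CR aL aR"

abbreviation cmp :: "'x \<times> 'z \<Rightarrow> 'm \<times> 'y \<times> 'w \<Rightarrow> 'm \<times> 'y \<times> 'w \<Rightarrow> 'm \<times> 'y \<times> 'w"
  where "cmp \<equiv> mixed_comp_rep M CL CR aL aR"

abbreviation step :: "'x \<times> 'z \<Rightarrow> 'x \<times> 'z \<Rightarrow> 'm \<times> 'y \<times> 'w \<Rightarrow> 'm \<times> 'y \<times> 'w \<Rightarrow> bool"
  where "step S T \<equiv> coend_step (Ground M) (mixed_set CL CR aL aR S T) (mixed_map CL CR aL aR S T)"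

lemma reps_iff: "(m, l, r) \<in> reps (X, X') (Y, Y') \<longleftrightarrow>
    m \<in> Obj (Ground M) \<and> l \<in> Hom CL X (actO aL m Y) \<and> r \<in> Hom CR (actO aR m Y') X'"
  by (auto simp: reps_def mixed_set_def)

text \<open>In a generating step the variable that does not move carries an identity, which acts
  trivially. What remains is the familiar sliding relation between \<open>l\<close> with
  \<open>r\<close> after \<open>f\<close> and \<open>l\<close> followed by \<open>f\<close> with
  \<open>r\<close>.\<close>

lemma step_iff:
  assumes "Y \<in> Obj CL" "Y' \<in> Obj CR"
  shows "step (X, X') (Y, Y') p q \<longleftrightarrow>
    (\<exists>m n. \<exists>f\<in>Hom (Ground M) m n. \<exists>l\<in>Hom CL X (actO aL m Y). \<exists>r\<in>Hom CR (actO aR n Y') X'.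
      p = (m, l, r \<cdot>\<^bsub>CR\<^esub> ActN aR f Y') \<and> q = (n, ActN aL f Y \<cdot>\<^bsub>CL\<^esub> l, r))"
proof -
  have "mixed_map CL CR aL aR (X, X') (Y, Y') f (Id (Ground M) (Dom (Ground M) f)) (l, r)
      = (l, r \<cdot>\<^bsub>CR\<^esub> ActN aR f Y')"
    "mixed_map CL CR aL aR (X, X') (Y, Y') (Id (Ground M) (Cod (Ground M) f)) f (l, r)
      = (ActN aL f Y \<cdot>\<^bsub>CL\<^esub> l, r)"
    if "f \<in> Arr (Ground M)" "l \<in> Hom CL X (actO aL (Dom (Ground M) f) Y)"
      "r \<in> Hom CR (actO aR (Cod (Ground M) f) Y') X'" for f l r
    using that assms
    by (simp_all add: mixed_map_def in_Hom_iff L.act_Id R.act_Id L.M.V.Dom_closed L.M.V.Cod_closed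
        L.cat.Id_Comp R.cat.Comp_Id)
  then show ?thesis
    unfolding coend_step_def by (fastforce simp: mixed_set_def in_Hom_iff)
qed

text \<open>A single step suffices for each identification of composites below. The two component
  equations are premises so that they can be matched with the left and right calculations for the
  actions.\<close>

lemma cls_eqI:
  assumes "Y \<in> Obj CL" "Y' \<in> Obj CR" "f \<in> Hom (Ground M) m n"
    and "l \<in> Hom CL X (actO aL m Y)" "r' \<in> Hom CR (actO aR n Y') X'"
    and "ActN aL f Y \<cdot>\<^bsub>CL\<^esub> l = l'" "r = r' \<cdot>\<^bsub>CR\<^esub> ActN aR f Y'"
  shows "cls (X, X') (Y, Y') (m, l, r) = cls (X, X') (Y, Y') (n, l', r')"
proof -
  have "step (X, X') (Y, Y') (m, l, r) (n, l', r')"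
    unfolding step_iff[OF assms(1,2)] using assms(3-) by blast
  then show ?thesis
    unfolding mixed_class_def by (intro coend_class_eqI r_into_equivclp)
qed

lemma cls_self: "p \<in> reps S T \<Longrightarrow> p \<in> cls S T p"
  unfolding mixed_class_def reps_def by (rule coend_class_self)

lemma cls_reps: "q \<in> cls S T p \<Longrightarrow> q \<in> reps S T"
  unfolding mixed_class_def reps_def coend_class_def by blast

lemma cls_respects:
  assumes "p' \<in> cls S T p" "\<And>p q. step S T p q \<Longrightarrow> F p = F q"
  shows "F p' = F p"
  using assms unfolding mixed_class_def by (rule coend_class_respects)

lemma id_rep_reps:
  "S \<in> Obj CL \<times> Obj CR \<Longrightarrow> mixed_id_rep M CR aL aR S \<in> reps S S"
  by (cases S) (simp add: mixed_id_rep_def reps_iff in_Hom_iff L.M.unit_closed L.unit_typing R.unit_typing)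

lemma cmp_reps:
  assumes "p \<in> reps S T" "q \<in> reps T U" "U \<in> Obj CL \<times> Obj CR"
  shows "cmp U q p \<in> reps S U"
  using assms by (cases S; cases T; cases U; cases p; cases q)
    (simp add: mixed_comp_rep_def reps_iff in_Hom_iff L.typing R.typing)

section \<open>Composition is independent of representatives\<close>

lemma cls_cmp_step1:
  assumes p: "step S T p p'" and q: "q \<in> reps T U"
    and T: "T \<in> Obj CL \<times> Obj CR" and U: "U \<in> Obj CL \<times> Obj CR"
  shows "cls S U (cmp U q p) = cls S U (cmp U q p')"
proof -
  obtain X X' Y Y' Z Z' where S: "S = (X, X')" and T': "T = (Y, Y')" and U': "U = (Z, Z')"
    by (metis surj_pair)
  obtain n l2 r2 where q': "q = (n, l2, r2)"
    by (metis surj_pair)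
  obtain m m' f l r where f: "f \<in> Hom (Ground M) m m'" and l: "l \<in> Hom CL X (actO aL m Y)"
    and r: "r \<in> Hom CR (actO aR m' Y') X'"
    and p': "p = (m, l, r \<cdot>\<^bsub>CR\<^esub> ActN aR f Y')" "p' = (m', ActN aL f Y \<cdot>\<^bsub>CL\<^esub> l, r)"
    using p T unfolding S T' by (auto simp: step_iff)
  have o: "m \<in> Obj (Ground M)" "m' \<in> Obj (Ground M)"
    using f L.M.V.Dom_closed L.M.V.Cod_closed by (auto simp: in_Hom_iff)
  have q'': "n \<in> Obj (Ground M)" "l2 \<in> Hom CL Y (actO aL n Z)" "r2 \<in> Hom CR (actO aR n Z') Y'"
    and z: "Z \<in> Obj CL" "Z' \<in> Obj CR" and y: "Y \<in> Obj CL" "Y' \<in> Obj CR"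
    using q U T unfolding q' T' U' by (auto simp: reps_iff)
  note t = f[unfolded in_Hom_iff] l[unfolded in_Hom_iff] r[unfolded in_Hom_iff]
    q''[unfolded in_Hom_iff] o z y
  show ?thesis
    unfolding S U' p' q' mixed_comp_rep_def prod.case
    by (rule cls_eqI[OF z, where f = "tensA M f (Id (Ground M) n)"])
      (use t L.cmp_left_natural1[OF f q''(1) z(1) l q''(2)]
        R.cmp_right_natural1[OF f q''(1) z(2) r q''(3)] in
        \<open>simp_all add: in_Hom_iff L.typing R.typing\<close>)
qed

lemma cls_cmp_step2:
  assumes p: "p \<in> reps S T" and q: "step T U q q'"
    and T: "T \<in> Obj CL \<times> Obj CR" and U: "U \<in> Obj CL \<times> Obj CR"
  shows "cls S U (cmp U q p) = cls S U (cmp U q' p)"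
proof -
  obtain X X' Y Y' Z Z' where S: "S = (X, X')" and T': "T = (Y, Y')" and U': "U = (Z, Z')"
    by (metis surj_pair)
  obtain m l1 r1 where p': "p = (m, l1, r1)"
    by (metis surj_pair)
  obtain n n' g l r where g: "g \<in> Hom (Ground M) n n'" and l: "l \<in> Hom CL Y (actO aL n Z)"
    and r: "r \<in> Hom CR (actO aR n' Z') Y'"
    and q': "q = (n, l, r \<cdot>\<^bsub>CR\<^esub> ActN aR g Z')" "q' = (n', ActN aL g Z \<cdot>\<^bsub>CL\<^esub> l, r)"
    using q U unfolding T' U' by (auto simp: step_iff)
  have o: "n \<in> Obj (Ground M)" "n' \<in> Obj (Ground M)"
    using g L.M.V.Dom_closed L.M.V.Cod_closed by (auto simp: in_Hom_iff)
  have p'': "m \<in> Obj (Ground M)" "l1 \<in> Hom CL X (actO aL m Y)" "r1 \<in> Hom CR (actO aR m Y') X'"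
    and z: "Z \<in> Obj CL" "Z' \<in> Obj CR" and y: "Y \<in> Obj CL" "Y' \<in> Obj CR"
    using p U T unfolding p' S T' U' by (auto simp: reps_iff)
  note t = g[unfolded in_Hom_iff] l[unfolded in_Hom_iff] r[unfolded in_Hom_iff]
    p''[unfolded in_Hom_iff] o z y
  show ?thesis
    unfolding S U' p' q' mixed_comp_rep_def prod.case
    by (rule cls_eqI[OF z, where f = "tensA M (Id (Ground M) m) g"])
      (use t L.cmp_left_natural2[OF g p''(1) z(1) p''(2) l]
        R.cmp_right_natural2[OF g p''(1) z(2) p''(3) r] in
        \<open>simp_all add: in_Hom_iff L.typing R.typing\<close>)
qed

text \<open>Composition is defined as a union over all pairs of representatives. The classes united
  all coincide, since each factor may be changed separately, and the union is nonempty because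
  \<open>p\<close> and \<open>q\<close> lie in their own classes.\<close>

lemma UN_cls_cmp:
  assumes p: "p \<in> reps S T" and q: "q \<in> reps T U"
    and T: "T \<in> Obj CL \<times> Obj CR" and U: "U \<in> Obj CL \<times> Obj CR"
  shows "(\<Union>p'\<in>cls S T p. \<Union>q'\<in>cls T U q. cls S U (cmp U q' p')) = cls S U (cmp U q p)"
proof -
  have "cls S U (cmp U q' p') = cls S U (cmp U q p)"
    if p': "p' \<in> cls S T p" and q': "q' \<in> cls T U q" for p' q'
  proof -
    have "cls S U (cmp U q' p') = cls S U (cmp U q' p)"
      using p' by (rule cls_respects) (rule cls_cmp_step1[OF _ cls_reps[OF q'] T U])
    also have "\<dots> = cls S U (cmp U q p)"
      using q' by (rule cls_respects) (rule cls_cmp_step2[OF p _ T U])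
    finally show ?thesis .
  qed
  then show ?thesis
    using cls_self[OF p] cls_self[OF q] by blast
qed

section \<open>Unit and associativity laws\<close>

lemma cls_cmp_id_right:
  assumes p: "p \<in> reps S T" and S: "S \<in> Obj CL \<times> Obj CR" and T: "T \<in> Obj CL \<times> Obj CR"
  shows "cls S T (cmp T p (mixed_id_rep M CR aL aR S)) = cls S T p"
proof -
  obtain X X' Y Y' where S': "S = (X, X')" and T': "T = (Y, Y')"
    by (metis surj_pair)
  obtain m l r where p': "p = (m, l, r)"
    by (metis surj_pair)
  have p'': "m \<in> Obj (Ground M)" "l \<in> Hom CL X (actO aL m Y)" "r \<in> Hom CR (actO aR m Y') X'"
    and x: "X \<in> Obj CL" "X' \<in> Obj CR" and y: "Y \<in> Obj CL" "Y' \<in> Obj CR"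
    using p S T unfolding p' S' T' by (auto simp: reps_iff)
  show ?thesis
    unfolding S' T' p' mixed_comp_rep_def mixed_id_rep_def prod.case
    \<comment> \<open>The earlier optic supplies the left tensor factor, so a preceding identity
      gives the representative \<open>I \<otimes> m\<close>; a following identity gives
      \<open>m \<otimes> I\<close> and calls for \<open>RUnit M m\<close>.\<close>
    by (rule cls_eqI[OF y, where f = "LUnit M m"])
      (use p'' x y L.cmp_left_lunit[OF p''(1) y(1) p''(2)] R.cmp_right_lunit[OF p''(1) y(2) p''(3)] in
        \<open>simp_all add: in_Hom_iff L.typing R.typing\<close>)
qed

lemma cls_cmp_id_left:
  assumes p: "p \<in> reps S T" and S: "S \<in> Obj CL \<times> Obj CR" and T: "T \<in> Obj CL \<times> Obj CR"
  shows "cls S T (cmp T (mixed_id_rep M CR aL aR T) p) = cls S T p"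
proof -
  obtain X X' Y Y' where S': "S = (X, X')" and T': "T = (Y, Y')"
    by (metis surj_pair)
  obtain m l r where p': "p = (m, l, r)"
    by (metis surj_pair)
  have p'': "m \<in> Obj (Ground M)" "l \<in> Hom CL X (actO aL m Y)" "r \<in> Hom CR (actO aR m Y') X'"
    and x: "X \<in> Obj CL" "X' \<in> Obj CR" and y: "Y \<in> Obj CL" "Y' \<in> Obj CR"
    using p S T unfolding p' S' T' by (auto simp: reps_iff)
  show ?thesis
    unfolding S' T' p' mixed_comp_rep_def mixed_id_rep_def prod.case
    by (rule cls_eqI[OF y, where f = "RUnit M m"])
      (use p'' x y L.cmp_left_runit[OF p''(1) y(1) p''(2)] R.cmp_right_runit[OF p''(1) y(2) p''(3)] in
        \<open>simp_all add: in_Hom_iff L.typing R.typing\<close>)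
qed

lemma cls_cmp_assoc:
  assumes p: "p \<in> reps S T" and q: "q \<in> reps T U" and k: "k \<in> reps U W"
    and W: "W \<in> Obj CL \<times> Obj CR"
  shows "cls S W (cmp W k (cmp U q p)) = cls S W (cmp W (cmp W k q) p)"
proof -
  obtain x x' y y' z z' w w' where
    objs: "S = (x, x')" "T = (y, y')" "U = (z, z')" "W = (w, w')"
    by (metis surj_pair)
  obtain m l1 r1 n l2 r2 i l3 r3 where
    reps: "p = (m, l1, r1)" "q = (n, l2, r2)" "k = (i, l3, r3)"
    by (metis surj_pair)
  have o: "m \<in> Obj (Ground M)" "n \<in> Obj (Ground M)" "i \<in> Obj (Ground M)"
    and l: "l1 \<in> Hom CL x (actO aL m y)" "l2 \<in> Hom CL y (actO aL n z)" "l3 \<in> Hom CL z (actO aL i w)"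
    and r: "r1 \<in> Hom CR (actO aR m y') x'" "r2 \<in> Hom CR (actO aR n z') y'"
      "r3 \<in> Hom CR (actO aR i w') z'"
    and w: "w \<in> Obj CL" "w' \<in> Obj CR"
    using p q k W unfolding objs reps by (auto simp: reps_iff)
  have yz: "y \<in> Obj CL" "z \<in> Obj CL" "y' \<in> Obj CR" "z' \<in> Obj CR"
    using l r L.cat.Dom_closed R.cat.Cod_closed by (auto simp: in_Hom_iff)
  note t = o w yz l[unfolded in_Hom_iff] r[unfolded in_Hom_iff]
  show ?thesis
    unfolding objs reps mixed_comp_rep_def prod.case
    \<comment> \<open>The two bracketings have representatives
      \<open>(m \<otimes> n) \<otimes> i\<close> and \<open>m \<otimes> (n \<otimes> i)\<close>, in
      the direction of the associator.\<close>
    by (rule cls_eqI[OF w, where f = "Assoc M m n i"])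
      (use t L.cmp_left_assoc[OF o w(1) l] R.cmp_right_assoc[OF o w(2) r] in
        \<open>simp_all add: in_Hom_iff L.typing R.typing\<close>)
qed

abbreviation optics :: "('x \<times> 'z, ('x \<times> 'z) \<times> ('x \<times> 'z) \<times> ('m \<times> 'y \<times> 'w) set) cat"
  where "optics \<equiv> mixed_optics M CL CR aL aR"

lemma Obj_optics: "Obj optics = Obj CL \<times> Obj CR"
  by (simp add: mixed_optics_def)

lemma Hom_optics_iff:
  "a \<in> Hom optics S T \<longleftrightarrow> S \<in> Obj CL \<times> Obj CR \<and> T \<in> Obj CL \<times> Obj CR \<and>
    (\<exists>p\<in>reps S T. a = (S, T, cls S T p))"
  by (auto simp: in_Hom_iff mixed_optics_def coend_def mixed_class_def reps_def)

lemma Comp_optics: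
  assumes "p \<in> reps S T" "q \<in> reps T U" "T \<in> Obj CL \<times> Obj CR" "U \<in> Obj CL \<times> Obj CR"
  shows "(T, U, cls T U q) \<cdot>\<^bsub>optics\<^esub> (S, T, cls S T p) = (S, U, cls S U (cmp U q p))"
  using UN_cls_cmp[OF assms] by (simp add: mixed_optics_def)

lemma Id_optics: "Id optics S = (S, S, cls S S (mixed_id_rep M CR aL aR S))"
  by (simp add: mixed_optics_def)

lemma category_optics: "category optics"
proof
  fix a assume "a \<in> Arr optics"
  then show "Dom optics a \<in> Obj optics" "Cod optics a \<in> Obj optics"
    by (auto simp: mixed_optics_def)
next
  fix S assume "S \<in> Obj optics"
  then show "Id optics S \<in> Hom optics S S"
    using id_rep_reps[of S] by (auto simp: Obj_optics Hom_optics_iff Id_optics)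
next
  fix a b S T U assume "a \<in> Hom optics S T" "b \<in> Hom optics T U"
  then show "b \<cdot>\<^bsub>optics\<^esub> a \<in> Hom optics S U"
    unfolding Hom_optics_iff using cmp_reps Comp_optics by blast
next
  fix a b c S T U W assume "a \<in> Hom optics S T" "b \<in> Hom optics T U" "c \<in> Hom optics U W"
  then show "(c \<cdot>\<^bsub>optics\<^esub> b) \<cdot>\<^bsub>optics\<^esub> a = c \<cdot>\<^bsub>optics\<^esub> (b \<cdot>\<^bsub>optics\<^esub> a)"
    unfolding Hom_optics_iff by (elim conjE bexE) (simp add: Comp_optics cmp_reps cls_cmp_assoc)
next
  fix a S T assume "a \<in> Hom optics S T"
  then show "Id optics T \<cdot>\<^bsub>optics\<^esub> a = a" "a \<cdot>\<^bsub>optics\<^esub> Id optics S = a"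
    unfolding Hom_optics_iff Id_optics
    by (elim conjE bexE; simp add: Comp_optics id_rep_reps cls_cmp_id_left cls_cmp_id_right)+
qed

end

section \<open>Comparison with dependent optics\<close>

text \<open>Transport of structure: every object and arrow of \<open>D\<close> is a relabelled one
  of \<open>C\<close>, so the axioms of \<open>D\<close> follow from those of
  \<open>C\<close>.\<close>

lemma iso_of_categories_relabel:
  assumes C: "category C" and inj: "inj (OMap F)" "inj (AMap F)"
    and Obj: "Obj D = OMap F ` Obj C" and Arr: "Arr D = AMap F ` Arr C"
    and Dom: "\<And>f. Dom D (AMap F f) = OMap F (Dom C f)"
    and Cod: "\<And>f. Cod D (AMap F f) = OMap F (Cod C f)"
    and Id: "\<And>X. Id D (OMap F X) = AMap F (Id C X)"
    and Comp: "\<And>f g. AMap F g \<cdot>\<^bsub>D\<^esub> AMap F f = AMap F (g \<cdot>\<^bsub>C\<^esub> f)"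
  shows "iso_of_categories C D F"
proof -
  interpret C: category C by (rule C)
  have Hom: "f \<in> Hom D X Y \<longleftrightarrow> (\<exists>g U V. g \<in> Hom C U V \<and> f = AMap F g \<and> X = OMap F U \<and> Y = OMap F V)"
    for f X Y
    by (auto simp: in_Hom_iff Arr Dom Cod)
  have eqs: "OMap F X = OMap F Y \<longleftrightarrow> X = Y" "AMap F f = AMap F g \<longleftrightarrow> f = g" for X Y f g
    using inj by (simp_all add: inj_eq)
  interpret D: category D
  proof
    fix f assume "f \<in> Arr D"
    then show "Dom D f \<in> Obj D" "Cod D f \<in> Obj D"
      by (auto simp: Arr Obj Dom Cod C.Dom_closed C.Cod_closed)
  next
    fix X assume "X \<in> Obj D"
    then show "Id D X \<in> Hom D X X"
      using C.Id_closed by (fastforce simp: Obj Id Hom)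
  next
    fix f X Y g Z assume "f \<in> Hom D X Y" "g \<in> Hom D Y Z"
    then show "g \<cdot>\<^bsub>D\<^esub> f \<in> Hom D X Z"
      using C.Comp_closed by (fastforce simp: Hom Comp eqs)
  next
    fix f W X g Y h Z assume "f \<in> Hom D W X" "g \<in> Hom D X Y" "h \<in> Hom D Y Z"
    then show "(h \<cdot>\<^bsub>D\<^esub> g) \<cdot>\<^bsub>D\<^esub> f = h \<cdot>\<^bsub>D\<^esub> (g \<cdot>\<^bsub>D\<^esub> f)"
      using C.Comp_assoc by (fastforce simp: Hom Comp eqs)
  next
    fix f X Y assume "f \<in> Hom D X Y"
    then show "Id D Y \<cdot>\<^bsub>D\<^esub> f = f" "f \<cdot>\<^bsub>D\<^esub> Id D X = f"
      using C.Id_left C.Id_right by (auto simp: Hom Comp Id)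
  qed
  \<comment> \<open>Injectivity on the whole types makes \<open>inv\<close> a left inverse
    everywhere; it is a right inverse on the images, which are exactly the carriers of
    \<open>D\<close>.\<close>
  let ?G = "\<lparr>OMap = inv (OMap F), AMap = inv (AMap F)\<rparr>"
  have "cat_functor C D F"
    by unfold_locales (auto simp: Obj Hom Id Comp)
  moreover have "cat_functor D C ?G"
    by unfold_locales (auto simp: Obj Hom Id Comp inj)
  moreover have "eq_ftr C (comp_ftr ?G F) id_ftr" "eq_ftr D (comp_ftr F ?G) id_ftr"
    by (auto simp: eq_ftr_def comp_ftr_def id_ftr_def Obj Arr inj)
  ultimately show ?thesis
    unfolding iso_of_categories_def by blast
qed

text \<open>Equality holds by unfolding alone: the only hom category is \<open>Ground M\<close>, the
  fibres are constantly \<open>CL\<close> and \<open>CR\<close>, and pulling back is acting.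
  Splitting \<open>S\<close> and \<open>T\<close> lets the pattern-matching definitions
  reduce.\<close>

lemma optic_class_deloop:
  "optic_class (deloop M) (deloop_action CL aL) (deloop_action CR aR) ((), S) ((), T)
    = mixed_class M CL CR aL aR S T"
  by (cases S; cases T)
    (simp add: optic_class_def mixed_class_def optic_set_def mixed_set_def optic_map_def mixed_map_def
      deloop_def deloop_action_def pullO_def actO_def)

lemma optic_hom_deloop:
  "optic_hom (deloop M) (deloop_action CL aL) (deloop_action CR aR) ((), S) ((), T)
    = coend (Ground M) (mixed_set CL CR aL aR S T) (mixed_map CL CR aL aR S T)"
  by (cases S; cases T)
    (simp add: optic_hom_def optic_set_def mixed_set_def optic_map_def mixed_map_def
      deloop_def deloop_action_def pullO_def actO_def)

lemma optic_id_rep_deloop: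
  "optic_id_rep (deloop M) (deloop_action CL aL) (deloop_action CR aR) ((), S)
    = mixed_id_rep M CR aL aR S"
  by (cases S) (simp add: optic_id_rep_def mixed_id_rep_def deloop_def deloop_action_def)

lemma optic_comp_rep_deloop:
  "optic_comp_rep (deloop M) (deloop_action CL aL) (deloop_action CR aR) () () ((), U) q p
    = mixed_comp_rep M CL CR aL aR U q p"
  by (cases U; cases p; cases q)
    (simp add: optic_comp_rep_def mixed_comp_rep_def deloop_def deloop_action_def comp1_def
      pullA_def actA_def)

lemma iso_mixed_to_dependent:
  assumes "category (mixed_optics M CL CR aL aR)"
  shows "iso_of_categories (mixed_optics M CL CR aL aR)
    (dependent_optics (deloop M) (deloop_action CL aL) (deloop_action CR aR)) mixed_to_dependent"
    (is "iso_of_categories ?C ?D ?F")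
proof (rule iso_of_categories_relabel[OF assms])
  have base: "BObj (deloop M) = {()}" "Fib (deloop_action CL aL) A = CL" "Fib (deloop_action CR aR) A = CR"
    for A by (simp_all add: deloop_def deloop_action_def)
  show "inj (OMap ?F)" "inj (AMap ?F)"
    by (auto simp: mixed_to_dependent_def inj_def)
  show "Obj ?D = OMap ?F ` Obj ?C"
    by (auto simp: mixed_to_dependent_def mixed_optics_def dependent_optics_def Let_def base)
  show "Arr ?D = AMap ?F ` Arr ?C"
    by (force simp: mixed_to_dependent_def mixed_optics_def dependent_optics_def Let_def base
        optic_hom_deloop image_iff)
  show "Dom ?D (AMap ?F f) = OMap ?F (Dom ?C f)" "Cod ?D (AMap ?F f) = OMap ?F (Cod ?C f)" for f
    by (simp_all add: mixed_to_dependent_def mixed_optics_def dependent_optics_def Let_def split: prod.split)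
  show "Id ?D (OMap ?F X) = AMap ?F (Id ?C X)" for X
    by (simp add: mixed_to_dependent_def mixed_optics_def dependent_optics_def Let_def
        optic_class_deloop optic_id_rep_deloop)
  show "AMap ?F g \<cdot>\<^bsub>?D\<^esub> AMap ?F f = AMap ?F (g \<cdot>\<^bsub>?C\<^esub> f)" for f g
    by (simp add: mixed_to_dependent_def mixed_optics_def dependent_optics_def Let_def
        optic_class_deloop optic_comp_rep_deloop split: prod.split)
qed

theorem proposition1:
  fixes M :: "('m, 'f) mon"
    and CL :: "('x, 'y) cat" and CR :: "('z, 'w) cat"
    and aL :: "('m, 'f, 'x, 'y) act" and aR :: "('m, 'f, 'z, 'w) act"
  assumes "monoidal_category M"
    and "category CL" and "category CR"
    and "action M CL aL" and "action M CR aR"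
  shows "bicategory (deloop M) \<and>
      (\<exists>!A. A \<in> BObj (deloop M)) \<and>
      indexed_category (deloop M) (deloop_action CL aL) \<and>
      indexed_category (deloop M) (deloop_action CR aR) \<and>
      iso_of_categories
        (mixed_optics M CL CR aL aR)
        (dependent_optics (deloop M) (deloop_action CL aL) (deloop_action CR aR))
        mixed_to_dependent"
proof -
  interpret mixed_actions M CL CR aL aR
    by (intro mixed_actions.intro assms)
  have "\<exists>!A. A \<in> BObj (deloop M)"
    by (rule ex1I[of _ "()"]) (simp_all add: deloop_def)
  then show ?thesis
    using bicategory_deloop[OF assms(1)] L.indexed_category_deloop_action
      R.indexed_category_deloop_action iso_mixed_to_dependent[OF category_optics]
    by blast
qed

end
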